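(* Let $T$ be a tree. Then the closed neighborhood ideal $NI(T)$ is bridge-friendly. Consequently, the Barile-Macchia resolution of $NI(T)$ (formed with respect to a total order on $\mathcal{G}(NI(T))$ witnessing bridge-friendliness) is minimal.
   Context: All graphs are finite and simple; a tree is a connected graph with no cycles. Let $T$ have vertex set $\{x_1,\dots,x_n\}$ and let $R=\mathbb{K}[x_1,\dots,x_n]$ with $\mathbb{K}$ a field. For a vertex $v$, $N_T[v]$ is the set consisting of $v$ and its neighbors, and $m(T,v)=\prod_{y\in N_T[v]}y\in R$. The closed neighborhood ideal is $NI(T)=\langle m(T,v): v\in V(T)\rangle$. For a monomial ideal $I$, $\mathcal{G}(I)$ is its set of minimal monomial generators. Fix a total order $>$ on $\mathcal{G}(I)$; say $m$ dominates $m'$ if $m>m'$. For $\sigma\subseteq\mathcal{G}(I)$ let $\mathrm{lcm}(\sigma)$ be the lcm of its elements (with $\mathrm{lcm}(\emptyset)=1$). For $m\in\mathcal{G}(I)$: - $m$ is a bridge of $\sigma$ if $m\in\sigma$ and $\mathrm{lcm}(\sigma)=\mathrm{lcm}(\sigma\setminus\{m\})$. - $m$ is a gap of $\sigma$ if $m\notin\sigma$ and $\mathrm{lcm}(\sigma)=\mathrm{lcm}(\sigma\cup\{m\})$. - $m$ is a true gap of $\sigma$ if $m$ is a gap of $\sigma$ and every bridge $m_2$ of $\sigma\cup\{m\}$ with $m>m_2$ is already a bridge of $\sigma$. - $\sigma$ is potentially type-2 if it has a bridge not dominating any true gap of $\sigma$. For $\sigma$ having a bridge, $\mathrm{sb}(\sigma)$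 denotes the smallest bridge of $\sigma$ with respect to $>$. - $\sigma$ is type-2 if it is potentially type-2 and for every potentially type-2 subset $\tau\neq\sigma$ of $\mathcal{G}(I)$ with $\sigma\setminus\{\mathrm{sb}(\sigma)\}=\tau\setminus\{\mathrm{sb}(\tau)\}$ one has $\mathrm{sb}(\tau)>\mathrm{sb}(\sigma)$. $I$ is bridge-friendly if there is a total order on $\mathcal{G}(I)$ for which every potentially type-2 subset of $\mathcal{G}(I)$ is type-2. The Barile-Macchia (BM) resolution of $R/I$ with respect to $>$ is the graded free resolution obtained from the Taylor resolution (whose basis in homological degree $r$ is the set of $r$-element subsets of $\mathcal{G}(I)$) by discrete Morse theory, using the homogeneous acyclic matching that pairs each type-2 subset $\sigma$ with $\sigma\setminus\{\mathrm{sb}(\sigma)\}$. The unmatched subsets are called critical, and the critical subsets $\sigma$ with $|\sigma|=r$ form a basis of the $r$-th free module, $\sigma$ having degree $\deg\mathrm{lcm}(\sigma)$. It is minimal if it is a minimal free resolution of $R/I$. *)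

theory Defs
  imports Complex_Main "HOL-Library.Poly_Mapping"
begin

section \<open>Trees\<close>

text \<open>
  A finite simple graph is a symmetric irreflexive adjacency relation on a finite type, whose
  elements are the vertices (and also the variables of the polynomial ring below).
\<close>

definition simple_graph :: "('v \<Rightarrow> 'v \<Rightarrow> bool) \<Rightarrow> bool" where
  "simple_graph E \<longleftrightarrow> symp E \<and> irreflp E"

definition connected_graph :: "('v \<Rightarrow> 'v \<Rightarrow> bool) \<Rightarrow> bool" where
  "connected_graph E \<longleftrightarrow> (\<forall>u v. E\<^sup>*\<^sup>* u v)"

definition graph_cycle :: "('v \<Rightarrow> 'v \<Rightarrow> bool) \<Rightarrow> 'v list \<Rightarrow> bool" where
  "graph_cycle E p \<longleftrightarrow>
     length p \<ge> 3 \<and> distinct p \<and> successively E p \<and> E (last p) (hd p)"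

definition tree :: "('v \<Rightarrow> 'v \<Rightarrow> bool) \<Rightarrow> bool" where
  "tree E \<longleftrightarrow> simple_graph E \<and> connected_graph E \<and> (\<nexists>p. graph_cycle E p)"

definition closed_nbhd :: "('v \<Rightarrow> 'v \<Rightarrow> bool) \<Rightarrow> 'v \<Rightarrow> 'v set" where
  "closed_nbhd E v = insert v {y. E v y}"


section \<open>Monomials and monomial ideals\<close>

text \<open>
  Monomials are represented by their exponent vectors; a polynomial maps each monomial to its
  coefficient, and the multiplication of the type of polynomials is convolution.
\<close>

type_synonym 'v mon = "'v \<Rightarrow>\<^sub>0 nat"
type_synonym ('v, 'k) mpol = "'v mon \<Rightarrow>\<^sub>0 'k"

definition monom :: "'v mon \<Rightarrow> ('v, 'k::comm_ring_1) mpol" where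
  "monom m = Poly_Mapping.single m 1"

definition var :: "'v \<Rightarrow> ('v, 'k::comm_ring_1) mpol" where
  "var v = monom (Poly_Mapping.single v 1)"

definition mon_deg :: "'v mon \<Rightarrow> nat" where
  "mon_deg m = (\<Sum>v\<in>Poly_Mapping.keys m. Poly_Mapping.lookup m v)"

definition ideal_gen :: "'a::comm_ring_1 set \<Rightarrow> 'a set" where
  "ideal_gen S = module.span (*) S"

definition closed_nbhd_ideal :: "('v::finite \<Rightarrow> 'v \<Rightarrow> bool) \<Rightarrow> ('v, 'k::field) mpol set" where
  "closed_nbhd_ideal E = ideal_gen {\<Prod>y\<in>closed_nbhd E v. var y | v. True}"

definition min_gens :: "('v, 'k::field) mpol set \<Rightarrow> 'v mon set" where
  "min_gens I = {m. monom m \<in> I \<and>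
     (\<forall>m'. monom m' \<in> I \<and> (monom m' :: ('v, 'k) mpol) dvd monom m \<longrightarrow> m' = m)}"

text \<open>The exponent vector of the lcm is the pointwise maximum; \<open>insert 0\<close> gives \<open>lcm \<emptyset> = 1\<close>.\<close>

definition mon_lcm :: "'v mon set \<Rightarrow> 'v mon" where
  "mon_lcm \<sigma> = Poly_Mapping.Abs_poly_mapping
     (\<lambda>v. Max (insert 0 ((\<lambda>m. Poly_Mapping.lookup m v) ` \<sigma>)))"


section \<open>Bridges, gaps and type-2 subsets\<close>

text \<open>
  Throughout, \<open>G\<close> is the set of minimal monomial generators and \<open>r\<close> a (reflexive) total order
  on it; a pair \<open>(a, b) \<in> r\<close> means \<open>a \<le> b\<close>.
\<close>

definition dominates :: "'v mon rel \<Rightarrow> 'v mon \<Rightarrow> 'v mon \<Rightarrow> bool" where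
  "dominates r m m' \<longleftrightarrow> (m', m) \<in> r \<and> m \<noteq> m'"

definition bridge :: "'v mon set \<Rightarrow> 'v mon \<Rightarrow> bool" where
  "bridge \<sigma> m \<longleftrightarrow> m \<in> \<sigma> \<and> mon_lcm \<sigma> = mon_lcm (\<sigma> - {m})"

definition gap :: "'v mon set \<Rightarrow> 'v mon set \<Rightarrow> 'v mon \<Rightarrow> bool" where
  "gap G \<sigma> m \<longleftrightarrow> m \<in> G \<and> m \<notin> \<sigma> \<and> mon_lcm \<sigma> = mon_lcm (insert m \<sigma>)"

definition true_gap :: "'v mon set \<Rightarrow> 'v mon rel \<Rightarrow> 'v mon set \<Rightarrow> 'v mon \<Rightarrow> bool" where
  "true_gap G r \<sigma> m \<longleftrightarrow> gap G \<sigma> m \<and>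
     (\<forall>m2. bridge (insert m \<sigma>) m2 \<and> dominates r m m2 \<longrightarrow> bridge \<sigma> m2)"

definition pot_type2 :: "'v mon set \<Rightarrow> 'v mon rel \<Rightarrow> 'v mon set \<Rightarrow> bool" where
  "pot_type2 G r \<sigma> \<longleftrightarrow> \<sigma> \<subseteq> G \<and>
     (\<exists>m. bridge \<sigma> m \<and> (\<forall>g. true_gap G r \<sigma> g \<longrightarrow> \<not> dominates r m g))"

text \<open>Smallest bridge; only meaningful when \<open>\<sigma>\<close> has a bridge.\<close>

definition sb :: "'v mon rel \<Rightarrow> 'v mon set \<Rightarrow> 'v mon" where
  "sb r \<sigma> = (THE m. bridge \<sigma> m \<and> (\<forall>m'. bridge \<sigma> m' \<longrightarrow> (m, m') \<in> r))"

definition type2 :: "'v mon set \<Rightarrow> 'v mon rel \<Rightarrow> 'v mon set \<Rightarrow> bool" where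
  "type2 G r \<sigma> \<longleftrightarrow> pot_type2 G r \<sigma> \<and>
     (\<forall>\<tau>. pot_type2 G r \<tau> \<and> \<tau> \<noteq> \<sigma> \<and> \<sigma> - {sb r \<sigma>} = \<tau> - {sb r \<tau>} \<longrightarrow>
          dominates r (sb r \<tau>) (sb r \<sigma>))"

definition bridge_friendly_wrt :: "('v, 'k::field) mpol set \<Rightarrow> 'v mon rel \<Rightarrow> bool" where
  "bridge_friendly_wrt I r \<longleftrightarrow> linear_order_on (min_gens I) r \<and>
     (\<forall>\<sigma>. pot_type2 (min_gens I) r \<sigma> \<longrightarrow> type2 (min_gens I) r \<sigma>)"

definition bridge_friendly :: "('v, 'k::field) mpol set \<Rightarrow> bool" where
  "bridge_friendly I \<longleftrightarrow> (\<exists>r. bridge_friendly_wrt I r)"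


section \<open>Minimal graded free resolutions\<close>

text \<open>
  A sequence of graded free modules with chosen homogeneous bases: \<open>basis C r\<close> is the basis of
  the \<open>r\<close>-th module, \<open>bdeg C b\<close> the degree of a basis element, and \<open>entry C b c\<close> the
  coefficient of \<open>c\<close> in the differential of \<open>b\<close>.  A homomorphism from the free module in degree 0
  to \<open>R/I\<close> is given by representatives \<open>aug C b\<close> in \<open>R\<close> of the images of the basis elements.
\<close>

record ('b, 'p) based_complex =
  basis :: "nat \<Rightarrow> 'b set"
  bdeg :: "'b \<Rightarrow> nat"
  entry :: "'b \<Rightarrow> 'b \<Rightarrow> 'p"
  aug :: "'b \<Rightarrow> 'p"

definition free_module ::
    "('b, ('v, 'k::field) mpol) based_complex \<Rightarrow> nat \<Rightarrow> ('b \<Rightarrow> ('v, 'k) mpol) set" where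
  "free_module C r = {f. \<forall>b. b \<notin> basis C r \<longrightarrow> f b = 0}"

text \<open>\<open>differential C r\<close> goes from the module in degree \<open>r + 1\<close> to the one in degree \<open>r\<close>.\<close>

definition differential ::
    "('b, ('v, 'k::field) mpol) based_complex \<Rightarrow> nat \<Rightarrow>
       ('b \<Rightarrow> ('v, 'k) mpol) \<Rightarrow> 'b \<Rightarrow> ('v, 'k) mpol" where
  "differential C r f =
     (\<lambda>c. if c \<in> basis C r then \<Sum>b\<in>basis C (Suc r). f b * entry C b c else 0)"

definition augmentation ::
    "('b, ('v, 'k::field) mpol) based_complex \<Rightarrow> ('b \<Rightarrow> ('v, 'k) mpol) \<Rightarrow> ('v, 'k) mpol" where
  "augmentation C f = (\<Sum>b\<in>basis C 0. f b * aug C b)"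

definition graded_free_resolution ::
    "('b, ('v, 'k::field) mpol) based_complex \<Rightarrow> ('v, 'k) mpol set \<Rightarrow> bool" where
  "graded_free_resolution C I \<longleftrightarrow>
     (\<forall>r. finite (basis C r)) \<and>
     \<comment> \<open>the maps are homogeneous of degree 0\<close>
     (\<forall>r. \<forall>b\<in>basis C (Suc r). \<forall>c\<in>basis C r. \<forall>t\<in>Poly_Mapping.keys (entry C b c).
        mon_deg t + bdeg C c = bdeg C b) \<and>
     (\<forall>b\<in>basis C 0. \<forall>t\<in>Poly_Mapping.keys (aug C b). mon_deg t = bdeg C b) \<and>
     \<comment> \<open>exactness at \<open>R/I\<close>, in degree 0 and in positive degrees\<close>
     (\<forall>p. \<exists>f\<in>free_module C 0. p - augmentation C f \<in> I) \<and>
     {f \<in> free_module C 0. augmentation C f \<in> I} = differential C 0 ` free_module C 1 \<and>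
     (\<forall>r. {f \<in> free_module C (Suc r). differential C r f = (\<lambda>_. 0)} =
          differential C (Suc r) ` free_module C (Suc (Suc r)))"

definition max_ideal :: "('v, 'k::field) mpol set" where
  "max_ideal = ideal_gen (range var)"

text \<open>
  Minimality: the differentials map into \<open>\<mm>F\<close>, where \<open>\<mm>\<close> is the ideal generated by the variables;
  for a free module \<open>F\<close> with a basis, \<open>\<mm>F\<close> consists of the elements with all coordinates in \<open>\<mm>\<close>.
\<close>

definition minimal_graded_free_resolution ::
    "('b, ('v, 'k::field) mpol) based_complex \<Rightarrow> ('v, 'k) mpol set \<Rightarrow> bool" where
  "minimal_graded_free_resolution C I \<longleftrightarrow>
     graded_free_resolution C I \<and>
     (\<forall>r. \<forall>f\<in>free_module C (Suc r). \<forall>c. differential C r f c \<in> max_ideal)"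


section \<open>The Barile-Macchia resolution\<close>

definition facet :: "'a set \<Rightarrow> 'a set \<Rightarrow> bool" where
  "facet \<sigma> \<tau> \<longleftrightarrow> (\<exists>m\<in>\<sigma>. \<tau> = \<sigma> - {m})"

text \<open>
  The sign \<open>[\<sigma> : \<tau>]\<close> in the Taylor differential, in which \<open>\<sigma>\<close> is mapped to the sum of
  \<open>[\<sigma> : \<tau>] (lcm \<sigma> / lcm \<tau>) \<tau>\<close> over the facets \<open>\<tau>\<close> of \<open>\<sigma>\<close>: the exponent is the
  position of the omitted generator in \<open>\<sigma>\<close>.
\<close>

definition incidence :: "'v mon rel \<Rightarrow> 'v mon set \<Rightarrow> 'v mon set \<Rightarrow> 'k::field" where
  "incidence r \<sigma> \<tau> =
     (if facet \<sigma> \<tau> then (- 1) ^ card {m' \<in> \<sigma>. \<exists>m\<in>\<sigma> - \<tau>. dominates r m m'} else 0)"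

definition bm_matching :: "'v mon set \<Rightarrow> 'v mon rel \<Rightarrow> ('v mon set \<times> 'v mon set) set" where
  "bm_matching G r = {(\<sigma>, \<sigma> - {sb r \<sigma>}) | \<sigma>. type2 G r \<sigma>}"

definition critical :: "'v mon set \<Rightarrow> 'v mon rel \<Rightarrow> 'v mon set \<Rightarrow> bool" where
  "critical G r \<sigma> \<longleftrightarrow> \<sigma> \<subseteq> G \<and> \<sigma> \<notin> fst ` bm_matching G r \<and> \<sigma> \<notin> snd ` bm_matching G r"

text \<open>
  The directed graph of the discrete Morse theory: an edge from each subset to each of its facets,
  with the edges of the matching reversed.  A reversed edge from \<open>\<sigma>\<close> to \<open>\<tau>\<close> has weight
  \<open>-[\<tau> : \<sigma>]\<^sup>-\<^sup>1 = -[\<tau> : \<sigma>]\<close>.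
\<close>

definition morse_edge ::
    "('v mon set \<times> 'v mon set) set \<Rightarrow> 'v mon set \<Rightarrow> 'v mon set \<Rightarrow> bool" where
  "morse_edge A \<sigma> \<tau> \<longleftrightarrow> (facet \<sigma> \<tau> \<and> (\<sigma>, \<tau>) \<notin> A) \<or> (\<tau>, \<sigma>) \<in> A"

definition edge_weight ::
    "('v mon set \<times> 'v mon set) set \<Rightarrow> 'v mon rel \<Rightarrow> 'v mon set \<Rightarrow> 'v mon set \<Rightarrow> 'k::field" where
  "edge_weight A r \<sigma> \<tau> = (if (\<tau>, \<sigma>) \<in> A then - incidence r \<tau> \<sigma> else incidence r \<sigma> \<tau>)"

definition gradient_paths ::
    "('v mon set \<times> 'v mon set) set \<Rightarrow> 'v mon set \<Rightarrow> 'v mon set \<Rightarrow> 'v mon set list set" where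
  "gradient_paths A \<sigma> \<tau> = {p. p \<noteq> [] \<and> hd p = \<sigma> \<and> last p = \<tau> \<and>
     distinct p \<and> successively (morse_edge A) p}"

definition path_weight ::
    "('v mon set \<times> 'v mon set) set \<Rightarrow> 'v mon rel \<Rightarrow> 'v mon set list \<Rightarrow> 'k::field" where
  "path_weight A r p = prod_list (map2 (edge_weight A r) (butlast p) (tl p))"

text \<open>
  The differential of the Morse complex (Batzies--Welker): the coefficient of \<open>\<tau>\<close> in the image of
  \<open>\<sigma>\<close> is the sum over the facets \<open>\<rho>\<close> of \<open>\<sigma>\<close> and the gradient paths \<open>p\<close> from \<open>\<rho>\<close> to \<open>\<tau>\<close> of
  the sign \<open>[\<sigma> : \<rho>]\<close> times the weight of \<open>p\<close>, times the monomial \<open>lcm \<sigma> / lcm \<tau>\<close>.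
  The augmentation sends the empty set to \<open>1\<close>.
\<close>

definition bm_resolution ::
    "('v, 'k::field) mpol set \<Rightarrow> 'v mon rel \<Rightarrow> ('v mon set, ('v, 'k) mpol) based_complex" where
  "bm_resolution I r = (let G = min_gens I; A = bm_matching G r in
     \<lparr> basis = (\<lambda>n. {\<sigma>. critical G r \<sigma> \<and> card \<sigma> = n}),
       bdeg = (\<lambda>\<sigma>. mon_deg (mon_lcm \<sigma>)),
       entry = (\<lambda>\<sigma> \<tau>. Poly_Mapping.single (mon_lcm \<sigma> - mon_lcm \<tau>)
         (\<Sum>\<rho> | facet \<sigma> \<rho>. incidence r \<sigma> \<rho> * (\<Sum>p\<in>gradient_paths A \<rho> \<tau>. path_weight A r p))),
       aug = (\<lambda>_. 1) \<rparr>)"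

end

theory Submission
  imports Defs
begin

text \<open>
  \<^bold>\<open>Bridge-friendliness.\<close>  Suppose that a potentially type-2 set fails to be type-2.  Unfolding the
  definitions yields generators \<open>a > b > c\<close> and variables \<open>x\<close>, \<open>y\<close> such that \<open>x\<close> divides \<open>b\<close> and
  \<open>c\<close> but not \<open>a\<close>, and \<open>y\<close> divides \<open>a\<close> and \<open>c\<close> but not \<open>b\<close> (\<open>pot_type2_imp_type2\<close>, stated for
  arbitrary exponents).  For closed neighborhoods in a tree this places the vertex of \<open>c\<close> strictly
  inside the path between the vertices of \<open>a\<close> and \<open>b\<close>.  Root the tree and let deeper vertices have
  smaller generators: then \<open>c\<close> is at least as deep as \<open>a\<close> and \<open>b\<close>, whereas one of them is a proper
  descendant of \<open>c\<close> (\<open>no_obstruction_in_forest\<close>).  Instead of the depth, the proof uses a numbering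
  of the vertices in which each has at most one smaller neighbor, which exists by removing leaves
  (\<open>forest_numbering\<close>).

  \<^bold>\<open>Resolution.\<close>  For any total order on the minimal generators of a monomial ideal, the
  Barile-Macchia complex is a graded free resolution (\<open>graded_free_resolution_bm\<close>).  The complex is
  multigraded, so exactness may be checked in each multidegree \<open>t\<close>, over the field.  There the Taylor
  complex becomes the chain complex of the simplex on the generators dividing \<open>t\<close>, which is a cone
  (\<open>simplex_exact\<close>).  The matching is acyclic because a zigzag that does not lower the lcm replaces
  a generator by a smaller one (\<open>edge_props\<close>).  The sums over gradient paths then form a projection of
  the simplex complex onto the span of the critical sets.  It kills the type-2 sets and their
  boundaries, hence is a chain map, and its kernel is spanned by these and is acyclic.  Exactness
  passes to the critical sets (\<open>morse_exact\<close>), and the components in all multidegrees are assembled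
  to polynomials (\<open>boundary_if_strands\<close>).

  \<^bold>\<open>Minimality.\<close>  If the order witnesses bridge-friendliness, then critical sets have no bridges
  (\<open>critical_no_bridge\<close>), so the first step of every gradient path from a critical set lowers the
  lcm and no entry of the differential is a nonzero constant (\<open>minimal_bm\<close>).
\<close>


section \<open>Divisibility and least common multiples of monomials\<close>

text \<open>Divisibility of monomials, as the pointwise order on exponent vectors.\<close>

definition mon_dvd :: "'v mon \<Rightarrow> 'v mon \<Rightarrow> bool" where
  "mon_dvd s t \<longleftrightarrow> (\<forall>v. Poly_Mapping.lookup s v \<le> Poly_Mapping.lookup t v)"

lemma mon_dvd_refl [simp]: "mon_dvd s s"
  by (simp add: mon_dvd_def)

lemma mon_dvd_trans: "mon_dvd s t \<Longrightarrow> mon_dvd t u \<Longrightarrow> mon_dvd s u"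
  unfolding mon_dvd_def by (meson order_trans)

lemma mon_dvd_antisym: "mon_dvd s t \<Longrightarrow> mon_dvd t s \<Longrightarrow> s = t"
  unfolding mon_dvd_def by (intro poly_mapping_eqI) (meson order_antisym)

lemma mon_dvd_diff_add: "mon_dvd s t \<Longrightarrow> t - s + s = t"
  unfolding mon_dvd_def by (intro poly_mapping_eqI) (simp add: lookup_add lookup_minus)

lemma mon_dvd_add [simp]: "mon_dvd s (t + s)"
  by (simp add: mon_dvd_def lookup_add)

lemma mon_deg_eq_sum_UNIV:
  fixes s :: "'v::finite mon"
  shows "mon_deg s = (\<Sum>v\<in>UNIV. Poly_Mapping.lookup s v)"
  unfolding mon_deg_def by (rule sum.mono_neutral_left) (auto simp: in_keys_iff)

lemma mon_deg_add:
  fixes s t :: "'v::finite mon"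
  shows "mon_deg (s + t) = mon_deg s + mon_deg t"
  by (simp add: mon_deg_eq_sum_UNIV lookup_add sum.distrib)

lemma mon_deg_less:
  fixes s t :: "'v::finite mon"
  assumes "mon_dvd s t" "s \<noteq> t"
  shows "mon_deg s < mon_deg t"
proof -
  obtain v where "Poly_Mapping.lookup s v \<noteq> Poly_Mapping.lookup t v"
    using assms(2) poly_mapping_eqI[of s t] by metis
  then have "Poly_Mapping.lookup s v < Poly_Mapping.lookup t v"
    using assms(1) by (simp add: mon_dvd_def order.strict_iff_order)
  then show ?thesis
    unfolding mon_deg_eq_sum_UNIV using assms(1) unfolding mon_dvd_def
    by (intro sum_strict_mono_ex1) auto
qed

lemma lookup_mon_lcm:
  fixes \<sigma> :: "'v::finite mon set"
  shows "Poly_Mapping.lookup (mon_lcm \<sigma>) v = Max (insert 0 ((\<lambda>m. Poly_Mapping.lookup m v) ` \<sigma>))"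
  unfolding mon_lcm_def by (subst Abs_poly_mapping_inverse) auto

lemma mon_lcm_dvd_iff:
  fixes \<sigma> :: "'v::finite mon set"
  assumes "finite \<sigma>"
  shows "mon_dvd (mon_lcm \<sigma>) t \<longleftrightarrow> (\<forall>m\<in>\<sigma>. mon_dvd m t)"
  using assms by (auto simp: mon_dvd_def lookup_mon_lcm)

lemma dvd_mon_lcm_iff:
  fixes \<sigma> :: "'v::finite mon set"
  assumes "finite \<sigma>"
  shows "mon_dvd m (mon_lcm \<sigma>) \<longleftrightarrow>
    (\<forall>v. Poly_Mapping.lookup m v = 0 \<or> (\<exists>n\<in>\<sigma>. Poly_Mapping.lookup m v \<le> Poly_Mapping.lookup n v))"
  using assms by (auto simp: mon_dvd_def lookup_mon_lcm Max_ge_iff)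

lemma dvd_mon_lcm: "finite \<sigma> \<Longrightarrow> m \<in> \<sigma> \<Longrightarrow> mon_dvd m (mon_lcm \<sigma>)" for \<sigma> :: "'v::finite mon set"
  by (auto simp: dvd_mon_lcm_iff)

lemma mon_lcm_mono:
  fixes \<sigma> :: "'v::finite mon set"
  assumes "finite \<tau>" "\<sigma> \<subseteq> \<tau>"
  shows "mon_dvd (mon_lcm \<sigma>) (mon_lcm \<tau>)"
  using assms by (simp add: mon_lcm_dvd_iff finite_subset dvd_mon_lcm subset_iff)

lemma mon_lcm_insert_eq_iff:
  fixes \<sigma> :: "'v::finite mon set"
  assumes "finite \<sigma>"
  shows "mon_lcm \<sigma> = mon_lcm (insert m \<sigma>) \<longleftrightarrow> mon_dvd m (mon_lcm \<sigma>)"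
proof
  assume "mon_dvd m (mon_lcm \<sigma>)"
  then have "mon_dvd (mon_lcm (insert m \<sigma>)) (mon_lcm \<sigma>)"
    using assms by (simp add: mon_lcm_dvd_iff dvd_mon_lcm)
  then show "mon_lcm \<sigma> = mon_lcm (insert m \<sigma>)"
    using assms by (meson finite_insert mon_dvd_antisym mon_lcm_mono subset_insertI)
qed (use assms dvd_mon_lcm[of "insert m \<sigma>" m] in auto)

lemma mon_lcm_empty [simp]: "mon_lcm {} = (0 :: 'v::finite mon)"
  by (intro poly_mapping_eqI) (simp add: lookup_mon_lcm)

lemma mon_dvd_zero_iff: "mon_dvd m 0 \<longleftrightarrow> m = 0"
  unfolding mon_dvd_def by (auto intro: poly_mapping_eqI)


section \<open>Monomial ideals\<close>

text \<open>
  \<open>t - u\<close> is truncated subtraction of exponents, which is the quotient only if \<open>u\<close> divides \<open>t\<close>.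
\<close>

lemma lookup_times_single:
  fixes p :: "('v, 'k::field) mpol"
  shows "Poly_Mapping.lookup (p * Poly_Mapping.single u c) t =
    (if mon_dvd u t then Poly_Mapping.lookup p (t - u) * c else 0)"
proof -
  have inner: "Sum_any (\<lambda>q. Poly_Mapping.lookup (Poly_Mapping.single u c) q when t = l + q) =
      (c when t = l + u)" for l
  proof -
    have "(\<lambda>q. Poly_Mapping.lookup (Poly_Mapping.single u c) q when t = l + q) =
        (\<lambda>q. (c when t = l + u) when q = u)"
      by (auto simp: lookup_single when_def fun_eq_iff)
    then show ?thesis by (simp only: Sum_any_when_equal)
  qed
  have iff: "t = l + u \<longleftrightarrow> mon_dvd u t \<and> l = t - u" for l
    by (metis add_diff_cancel_right' mon_dvd_add mon_dvd_diff_add)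
  have outer: "(\<lambda>l. Poly_Mapping.lookup p l * (c when t = l + u)) =
      (\<lambda>l. ((Poly_Mapping.lookup p l * c) when mon_dvd u t) when l = t - u)"
    by (auto simp: iff when_def fun_eq_iff)
  show ?thesis
    unfolding lookup_mult inner outer Sum_any_when_equal by (simp add: when_def)
qed

lemma monom_mult: "(monom s :: ('v, 'k::field) mpol) * monom t = monom (s + t)"
  by (simp add: monom_def mult_single)

lemma monom_dvd_iff: "(monom s :: ('v, 'k::field) mpol) dvd monom t \<longleftrightarrow> mon_dvd s t"
proof
  assume "(monom s :: ('v, 'k) mpol) dvd monom t"
  then obtain q :: "('v, 'k) mpol" where q: "monom t = q * monom s"
    by (metis dvdE mult.commute)
  have "Poly_Mapping.lookup (q * monom s) t \<noteq> 0"
    by (subst q[symmetric]) (simp add: monom_def)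
  then show "mon_dvd s t"
    unfolding monom_def lookup_times_single by (auto split: if_splits)
next
  assume "mon_dvd s t"
  then have "(monom t :: ('v, 'k) mpol) = monom s * monom (t - s)"
    by (simp add: monom_mult mon_dvd_diff_add add.commute[of s])
  then show "(monom s :: ('v, 'k) mpol) dvd monom t"
    by (rule dvdI)
qed

lemma module_times: "module ((*) :: 'a \<Rightarrow> 'a \<Rightarrow> 'a::comm_ring_1)"
  by unfold_locales (simp_all add: algebra_simps)

lemma mpol_eq_sum_monom:
  fixes p :: "('v, 'k::field) mpol"
  shows "p = (\<Sum>t\<in>Poly_Mapping.keys p. Poly_Mapping.single 0 (Poly_Mapping.lookup p t) * monom t)"
proof (rule poly_mapping_eqI)
  fix k
  show "Poly_Mapping.lookup p k = Poly_Mapping.lookup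
      (\<Sum>t\<in>Poly_Mapping.keys p. Poly_Mapping.single 0 (Poly_Mapping.lookup p t) * monom t) k"
    by (simp add: lookup_sum monom_def mult_single lookup_single when_def in_keys_iff)
qed

text \<open>A polynomial lies in a monomial ideal iff each of its monomials is divisible by a generator.\<close>

lemma monomial_ideal_iff:
  fixes p :: "('v, 'k::field) mpol"
  shows "p \<in> ideal_gen (monom ` S) \<longleftrightarrow>
    (\<forall>t. Poly_Mapping.lookup p t \<noteq> 0 \<longrightarrow> (\<exists>s\<in>S. mon_dvd s t))"
proof
  interpret module "(*) :: ('v, 'k) mpol \<Rightarrow> _" by (rule module_times)
  assume "p \<in> ideal_gen (monom ` S)"
  then obtain A q where A: "A \<subseteq> monom ` S" "p = (\<Sum>a\<in>A. q a * a)"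
    unfolding ideal_gen_def span_explicit by auto
  show "\<forall>t. Poly_Mapping.lookup p t \<noteq> 0 \<longrightarrow> (\<exists>s\<in>S. mon_dvd s t)"
  proof (intro allI impI)
    fix t
    assume "Poly_Mapping.lookup p t \<noteq> 0"
    then obtain a where a: "a \<in> A" "Poly_Mapping.lookup (q a * a) t \<noteq> 0"
      unfolding A lookup_sum by (meson sum.neutral)
    then obtain s where "s \<in> S" "a = monom s" using A by auto
    with a show "\<exists>s\<in>S. mon_dvd s t"
      unfolding monom_def by (auto simp: lookup_times_single split: if_splits)
  qed
next
  interpret module "(*) :: ('v, 'k) mpol \<Rightarrow> _" by (rule module_times)
  assume *: "\<forall>t. Poly_Mapping.lookup p t \<noteq> 0 \<longrightarrow> (\<exists>s\<in>S. mon_dvd s t)"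
  have "(\<Sum>t\<in>Poly_Mapping.keys p. Poly_Mapping.single 0 (Poly_Mapping.lookup p t) * monom t)
      \<in> span (monom ` S)"
  proof (rule span_sum)
    fix t
    assume "t \<in> Poly_Mapping.keys p"
    then obtain s where s: "s \<in> S" "mon_dvd s t" using * by (auto simp: in_keys_iff)
    then have "(monom t :: ('v, 'k) mpol) = monom (t - s) * monom s"
      by (simp add: monom_mult mon_dvd_diff_add)
    then have "(monom t :: ('v, 'k) mpol) \<in> span (monom ` S)"
      using s(1) by (metis imageI span_base span_scale)
    then show "Poly_Mapping.single 0 (Poly_Mapping.lookup p t) * monom t \<in> span (monom ` S)"
      by (rule span_scale)
  qed
  then show "p \<in> ideal_gen (monom ` S)"
    unfolding ideal_gen_def by (subst mpol_eq_sum_monom)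
qed

lemma monom_mem_monomial_ideal_iff:
  "(monom t :: ('v, 'k::field) mpol) \<in> ideal_gen (monom ` S) \<longleftrightarrow> (\<exists>s\<in>S. mon_dvd s t)"
  unfolding monomial_ideal_iff by (auto simp: monom_def lookup_single when_def)

lemma min_gens_monomial_ideal:
  "min_gens (ideal_gen (monom ` S) :: ('v, 'k::field) mpol set) =
    {m \<in> S. \<forall>s\<in>S. mon_dvd s m \<longrightarrow> s = m}"
  unfolding min_gens_def monom_mem_monomial_ideal_iff monom_dvd_iff
  by (auto, (metis mon_dvd_refl mon_dvd_trans mon_dvd_antisym)+)

lemma min_gens_dvd_iff:
  fixes S :: "'v::finite mon set"
  shows "(\<exists>m\<in>min_gens (ideal_gen (monom ` S) :: ('v, 'k::field) mpol set). mon_dvd m t) \<longleftrightarrow>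
    (\<exists>s\<in>S. mon_dvd s t)"
proof
  assume "\<exists>s\<in>S. mon_dvd s t"
  then obtain s where s: "s \<in> S \<and> mon_dvd s t"
      and least: "\<And>u. u \<in> S \<and> mon_dvd u t \<Longrightarrow> mon_deg s \<le> mon_deg u"
    using ex_has_least_nat[of "\<lambda>s. s \<in> S \<and> mon_dvd s t" _ mon_deg] by blast
  have "u = s" if "u \<in> S" "mon_dvd u s" for u
    using least[of u] s that mon_deg_less[of u s] mon_dvd_trans[of u s t] by fastforce
  with s show "\<exists>m\<in>min_gens (ideal_gen (monom ` S) :: ('v, 'k) mpol set). mon_dvd m t"
    unfolding min_gens_monomial_ideal by blast
qed (auto simp: min_gens_monomial_ideal)


section \<open>Bridges and the Barile-Macchia matching\<close>

text \<open>
  A finite set of monomials with a total order.  The combinatorics of bridges and gradient paths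
  does not use that the monomials are the minimal generators of an ideal.
\<close>

locale ordered_gens =
  fixes G :: "'v::finite mon set" and r :: "'v mon rel"
  assumes finite_G: "finite G" and linear: "linear_order_on G r"
begin

text \<open>The position of a generator in the order; it turns comparisons into ones of naturals.\<close>

definition rk :: "'v mon \<Rightarrow> nat" where
  "rk m = card {a \<in> G. (a, m) \<in> r}"

lemma le_iff_rk:
  assumes "a \<in> G" "b \<in> G"
  shows "(a, b) \<in> r \<longleftrightarrow> rk a \<le> rk b"
proof
  have trans: "trans r" and refl: "refl_on G r" and anti: "antisym r" and tot: "total_on G r"
    using linear by (auto simp: order_on_defs)
  show "rk a \<le> rk b" if "(a, b) \<in> r"
    unfolding rk_def using that trans finite_G
    by (intro card_mono) (auto dest: transD)
  show "(a, b) \<in> r" if le: "rk a \<le> rk b"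
  proof (rule ccontr)
    assume nab: "(a, b) \<notin> r"
    then have ba: "(b, a) \<in> r"
      using tot refl assms by (metis refl_onD total_on_def)
    have "{c \<in> G. (c, b) \<in> r} \<subset> {c \<in> G. (c, a) \<in> r}"
      using ba nab trans refl assms by (auto dest: transD refl_onD)
    then have "rk b < rk a"
      unfolding rk_def using finite_G by (intro psubset_card_mono) auto
    then show False using le by simp
  qed
qed

lemma rk_inj:
  assumes "a \<in> G" "b \<in> G" "rk a = rk b"
  shows "a = b"
  using assms le_iff_rk[of a b] le_iff_rk[of b a] linear
  by (auto simp: order_on_defs dest: antisymD)

lemma dominates_iff_rk:
  assumes "a \<in> G" "b \<in> G"
  shows "dominates r a b \<longleftrightarrow> rk b < rk a"
  unfolding dominates_def using le_iff_rk[of b a] rk_inj[of a b] assms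
  by (auto simp: order.strict_iff_order)

lemma finite_sub: "\<sigma> \<subseteq> G \<Longrightarrow> finite \<sigma>"
  using finite_G finite_subset by blast

lemma bridge_iff:
  assumes "\<sigma> \<subseteq> G"
  shows "bridge \<sigma> m \<longleftrightarrow> m \<in> \<sigma> \<and> mon_dvd m (mon_lcm (\<sigma> - {m}))"
proof (cases "m \<in> \<sigma>")
  case True
  then have "insert m (\<sigma> - {m}) = \<sigma>" by auto
  then show ?thesis
    using mon_lcm_insert_eq_iff[of "\<sigma> - {m}" m] finite_sub[OF assms] True
    unfolding bridge_def by (metis finite_Diff)
qed (simp add: bridge_def)

lemma gap_iff:
  assumes "\<sigma> \<subseteq> G"
  shows "gap G \<sigma> m \<longleftrightarrow> m \<in> G \<and> m \<notin> \<sigma> \<and> mon_dvd m (mon_lcm \<sigma>)"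
  unfolding gap_def using mon_lcm_insert_eq_iff[of \<sigma> m] finite_sub[OF assms] by auto

lemma bridge_mono:
  assumes "bridge \<sigma> m" "\<sigma> \<subseteq> \<tau>" "\<tau> \<subseteq> G"
  shows "bridge \<tau> m"
proof -
  have "mon_dvd (mon_lcm (\<sigma> - {m})) (mon_lcm (\<tau> - {m}))"
    by (rule mon_lcm_mono) (use assms finite_sub in auto)
  then show ?thesis
    using assms bridge_iff[of \<sigma>] bridge_iff[of \<tau>] mon_dvd_trans by blast
qed

lemma bridge_mem: "bridge \<sigma> m \<Longrightarrow> m \<in> \<sigma>"
  by (simp add: bridge_def)

lemma sb_eqI:
  assumes "\<sigma> \<subseteq> G" "bridge \<sigma> m" "\<And>m'. bridge \<sigma> m' \<Longrightarrow> rk m \<le> rk m'"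
  shows "sb r \<sigma> = m"
  unfolding sb_def
proof (rule the_equality)
  show "bridge \<sigma> m \<and> (\<forall>m'. bridge \<sigma> m' \<longrightarrow> (m, m') \<in> r)"
    using assms bridge_mem le_iff_rk by (metis subsetD)
next
  fix n
  assume n: "bridge \<sigma> n \<and> (\<forall>m'. bridge \<sigma> m' \<longrightarrow> (n, m') \<in> r)"
  then have "m \<in> G" "n \<in> G" using assms bridge_mem by (meson subsetD)+
  moreover have "rk n \<le> rk m" using n assms calculation le_iff_rk by blast
  ultimately show "n = m" using n assms(3)[of n] rk_inj by (metis order_antisym)
qed

lemma sb_bridge_least:
  assumes "\<sigma> \<subseteq> G" "bridge \<sigma> m"
  shows "bridge \<sigma> (sb r \<sigma>)" and "rk (sb r \<sigma>) \<le> rk m"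
proof -
  obtain n where n: "bridge \<sigma> n" "\<And>m'. bridge \<sigma> m' \<Longrightarrow> rk n \<le> rk m'"
    using ex_has_least_nat[of "bridge \<sigma>" m rk] assms(2) by blast
  then have "sb r \<sigma> = n" using sb_eqI assms(1) by blast
  then show "bridge \<sigma> (sb r \<sigma>)" "rk (sb r \<sigma>) \<le> rk m" using n assms(2) by auto
qed

text \<open>It suffices to test the smallest bridge in the definition of a potentially type-2 set.\<close>

lemma pot_type2_iff:
  "pot_type2 G r \<sigma> \<longleftrightarrow> \<sigma> \<subseteq> G \<and> (\<exists>m. bridge \<sigma> m) \<and> (\<forall>g. true_gap G r \<sigma> g \<longrightarrow> rk (sb r \<sigma>) < rk g)"
proof
  assume *: "pot_type2 G r \<sigma>"
  then obtain m where m: "\<sigma> \<subseteq> G" "bridge \<sigma> m"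
      and no: "\<And>g. true_gap G r \<sigma> g \<Longrightarrow> \<not> dominates r m g"
    unfolding pot_type2_def by blast
  have "rk (sb r \<sigma>) < rk g" if "true_gap G r \<sigma> g" for g
  proof -
    have g: "g \<in> G" "g \<notin> \<sigma>" using that by (auto simp: true_gap_def gap_def)
    have "m \<in> \<sigma>" using m bridge_mem by blast
    then have "rk m \<le> rk g" "m \<noteq> g"
      using g m no[OF that] dominates_iff_rk[of m g] by auto
    then have "rk m < rk g"
      using rk_inj[of m g] \<open>m \<in> \<sigma>\<close> g(1) m(1) by (metis order.strict_iff_order subsetD)
    then show ?thesis
      using sb_bridge_least(2)[OF m] by linarith
  qed
  then show "\<sigma> \<subseteq> G \<and> (\<exists>m. bridge \<sigma> m) \<and> (\<forall>g. true_gap G r \<sigma> g \<longrightarrow> rk (sb r \<sigma>) < rk g)"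
    using m by blast
next
  assume *: "\<sigma> \<subseteq> G \<and> (\<exists>m. bridge \<sigma> m) \<and> (\<forall>g. true_gap G r \<sigma> g \<longrightarrow> rk (sb r \<sigma>) < rk g)"
  then have b: "bridge \<sigma> (sb r \<sigma>)" using sb_bridge_least by blast
  have "\<not> dominates r (sb r \<sigma>) g" if "true_gap G r \<sigma> g" for g
  proof -
    have "g \<in> G" using that by (auto simp: true_gap_def gap_def)
    then show ?thesis
      using * that b bridge_mem[OF b] dominates_iff_rk[of "sb r \<sigma>" g] by fastforce
  qed
  then show "pot_type2 G r \<sigma>"
    unfolding pot_type2_def using * b by blast
qed

text \<open>The partner of a type-2 set in the matching; the term is of interest for such sets only.\<close>

abbreviation mate :: "'v mon set \<Rightarrow> 'v mon set" where
  "mate \<sigma> \<equiv> \<sigma> - {sb r \<sigma>}"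

lemma pot_type2_sub: "pot_type2 G r \<sigma> \<Longrightarrow> \<sigma> \<subseteq> G"
  by (simp add: pot_type2_def)

lemma pot_type2_sb: "pot_type2 G r \<sigma> \<Longrightarrow> bridge \<sigma> (sb r \<sigma>)"
  unfolding pot_type2_iff using sb_bridge_least by blast

lemma mon_lcm_mate: "pot_type2 G r \<sigma> \<Longrightarrow> mon_lcm (mate \<sigma>) = mon_lcm \<sigma>"
  using pot_type2_sb unfolding bridge_def by metis

lemma type2_pot: "type2 G r \<sigma> \<Longrightarrow> pot_type2 G r \<sigma>"
  by (simp add: type2_def)

text \<open>
  The removed bridge is a true gap of the mate and lies below all bridges of the mate.  Hence no
  set is both the upper and the lower end of a matched pair.
\<close>

lemma mate_not_pot_type2:
  assumes \<tau>: "pot_type2 G r \<tau>"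
  shows "\<not> pot_type2 G r (mate \<tau>)"
proof
  let ?b = "sb r \<tau>"
  assume *: "pot_type2 G r (mate \<tau>)"
  have sub: "\<tau> \<subseteq> G" and b: "bridge \<tau> ?b" using \<tau> pot_type2_sub pot_type2_sb by auto
  have b\<tau>: "insert ?b (mate \<tau>) = \<tau>" using bridge_mem[OF b] by auto
  have no_smaller: "\<not> dominates r ?b m" if "bridge \<tau> m" for m
    using that sb_bridge_least(2)[OF sub that] bridge_mem[OF that] bridge_mem[OF b] sub
    by (subst dominates_iff_rk) auto
  have "gap G (mate \<tau>) ?b"
    unfolding gap_def using bridge_mem[OF b] sub b\<tau> mon_lcm_mate[OF \<tau>] by auto
  then have tg: "true_gap G r (mate \<tau>) ?b"
    unfolding true_gap_def b\<tau> using no_smaller by blast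
  have bm: "bridge (mate \<tau>) (sb r (mate \<tau>))" using pot_type2_sb[OF *] .
  then have "rk ?b \<le> rk (sb r (mate \<tau>))"
    using sb_bridge_least(2)[OF sub] bridge_mono[OF bm _ sub] by blast
  moreover have "rk (sb r (mate \<tau>)) < rk ?b"
    using * tg unfolding pot_type2_iff by blast
  ultimately show False by simp
qed

lemma mate_inj:
  assumes "type2 G r \<sigma>" "type2 G r \<tau>" "mate \<sigma> = mate \<tau>"
  shows "\<sigma> = \<tau>"
proof (rule ccontr)
  assume "\<sigma> \<noteq> \<tau>"
  then have "dominates r (sb r \<tau>) (sb r \<sigma>)" "dominates r (sb r \<sigma>) (sb r \<tau>)"
    using assms unfolding type2_def by metis+
  moreover have "sb r \<tau> \<in> G" "sb r \<sigma> \<in> G"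
    using assms(1,2) type2_pot pot_type2_sb bridge_mem pot_type2_sub by (meson subsetD)+
  ultimately show False using dominates_iff_rk by fastforce
qed

lemma mem_bm_matching_iff: "(\<sigma>, \<tau>) \<in> bm_matching G r \<longleftrightarrow> type2 G r \<sigma> \<and> \<tau> = mate \<sigma>"
  by (auto simp: bm_matching_def)

lemma critical_iff:
  "critical G r \<sigma> \<longleftrightarrow> \<sigma> \<subseteq> G \<and> \<not> type2 G r \<sigma> \<and> (\<forall>\<tau>. type2 G r \<tau> \<longrightarrow> \<sigma> \<noteq> mate \<tau>)"
proof -
  have "\<sigma> \<in> fst ` bm_matching G r \<longleftrightarrow> type2 G r \<sigma>"
    unfolding image_iff Bex_def split_paired_Ex fst_conv mem_bm_matching_iff by blast
  moreover have "\<sigma> \<in> snd ` bm_matching G r \<longleftrightarrow> (\<exists>\<tau>. type2 G r \<tau> \<and> \<sigma> = mate \<tau>)"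
    unfolding image_iff Bex_def split_paired_Ex snd_conv mem_bm_matching_iff by blast
  ultimately show ?thesis unfolding critical_def by blast
qed

lemma mate_not_type2: "type2 G r \<tau> \<Longrightarrow> \<not> type2 G r (mate \<tau>)"
  using mate_not_pot_type2 type2_pot by blast

lemma card_mate: "type2 G r \<sigma> \<Longrightarrow> Suc (card (mate \<sigma>)) = card \<sigma>"
  using pot_type2_sb[OF type2_pot] bridge_mem finite_sub[OF pot_type2_sub[OF type2_pot]]
  by (metis card_Suc_Diff1)

text \<open>
  For a bridge-friendly order a critical set has no bridges: otherwise it has a true gap below all
  its bridges, and adjoining the smallest true gap yields a type-2 set that is matched with it.
\<close>

lemma critical_no_bridge:
  assumes friendly: "\<And>\<sigma>. pot_type2 G r \<sigma> \<Longrightarrow> type2 G r \<sigma>"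
    and crit: "critical G r \<sigma>"
  shows "\<not> bridge \<sigma> m"
proof
  assume m: "bridge \<sigma> m"
  have sub: "\<sigma> \<subseteq> G" using crit by (simp add: critical_def)
  have "\<not> pot_type2 G r \<sigma>" using crit friendly by (auto simp: critical_iff)
  then obtain g0 where g0: "true_gap G r \<sigma> g0" "rk g0 \<le> rk (sb r \<sigma>)"
    using sub m unfolding pot_type2_iff by (meson leI)
  obtain g where g: "true_gap G r \<sigma> g" and least: "\<And>h. true_gap G r \<sigma> h \<Longrightarrow> rk g \<le> rk h"
    using ex_has_least_nat[of "true_gap G r \<sigma>" g0 rk] g0(1) by blast
  have gG: "g \<in> G" "g \<notin> \<sigma>" and lcm: "mon_lcm \<sigma> = mon_lcm (insert g \<sigma>)"
    using g by (auto simp: true_gap_def gap_def)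
  have small: "rk g < rk n" if "bridge \<sigma> n" for n
  proof -
    have "rk g \<le> rk n"
      using least[OF g0(1)] g0(2) sb_bridge_least(2)[OF sub that] by linarith
    moreover have "g \<noteq> n" "n \<in> G" using gG(2) bridge_mem[OF that] sub by auto
    ultimately show ?thesis using gG(1) rk_inj[of g n] by (meson order.not_eq_order_implies_strict)
  qed
  let ?\<tau> = "insert g \<sigma>"
  have \<tau>: "?\<tau> \<subseteq> G" using sub gG by auto
  have bg: "bridge ?\<tau> g" unfolding bridge_def using lcm gG by auto
  have min_bridge: "rk g \<le> rk n" if "bridge ?\<tau> n" for n
  proof (rule ccontr)
    assume "\<not> rk g \<le> rk n"
    then have "dominates r g n"
      using bridge_mem[OF that] \<tau> gG by (subst dominates_iff_rk) auto
    then have "bridge \<sigma> n" using g that unfolding true_gap_def by blast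
    then show False using small[of n] \<open>\<not> rk g \<le> rk n\<close> by simp
  qed
  have sb: "sb r ?\<tau> = g" by (rule sb_eqI[OF \<tau> bg min_bridge])
  have "rk g < rk h" if h: "true_gap G r ?\<tau> h" for h
  proof (rule ccontr)
    assume hg: "\<not> rk g < rk h"
    have hG: "h \<in> G" "h \<notin> ?\<tau>" and "mon_dvd h (mon_lcm ?\<tau>)"
      using h gap_iff[OF \<tau>] by (auto simp: true_gap_def)
    then have gap: "gap G \<sigma> h" using gap_iff[OF sub] lcm by auto
    have "\<not> (bridge (insert h \<sigma>) n \<and> dominates r h n)" for n
    proof
      assume n: "bridge (insert h \<sigma>) n \<and> dominates r h n"
      have "bridge (insert h ?\<tau>) n"
        by (rule bridge_mono[of "insert h \<sigma>"]) (use n \<tau> hG in auto)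
      then have "bridge ?\<tau> n" using h n unfolding true_gap_def by blast
      moreover have "rk n < rk h"
        using n bridge_mem[of "insert h \<sigma>" n] sub hG dominates_iff_rk[of h n] by blast
      ultimately show False using min_bridge[of n] hg by linarith
    qed
    then have "true_gap G r \<sigma> h" using gap unfolding true_gap_def by blast
    then have "rk g = rk h" using least[of h] hg by simp
    then show False using rk_inj gG hG by blast
  qed
  then have "type2 G r ?\<tau>"
    using friendly pot_type2_iff[of ?\<tau>] \<tau> bg sb by auto
  moreover have "\<sigma> = mate ?\<tau>" using sb gG by auto
  ultimately show False using crit by (auto simp: critical_iff)
qed

end


section \<open>Gradient paths\<close>

context ordered_gens
begin

text \<open>An edge of the graph in which gradient paths run.\<close>

abbreviation edge :: "'v mon set \<Rightarrow> 'v mon set \<Rightarrow> bool" where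
  "edge \<equiv> morse_edge (bm_matching G r)"

text \<open>
  The level of a set is its cardinality, except that a type-2 set has the level of its mate.
  Levels do not increase along the edges of the Morse graph.
\<close>

definition level :: "'v mon set \<Rightarrow> nat" where
  "level \<sigma> = (if type2 G r \<sigma> then card \<sigma> - 1 else card \<sigma>)"

text \<open>
  Edges of the Morse graph decrease this well-founded order.  The essential component is the
  third one: a zigzag that leaves level and lcm unchanged replaces a bridge by a smaller generator.
\<close>

definition descent :: "('v mon set \<times> 'v mon set) set" where
  "descent = measures [level, \<lambda>\<sigma>. mon_deg (mon_lcm \<sigma>),
     \<lambda>\<sigma>. sum rk (if type2 G r \<sigma> then mate \<sigma> else \<sigma>), \<lambda>\<sigma>. if type2 G r \<sigma> then 0 else 1]"

lemma wf_descent: "wf descent"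
  by (simp add: descent_def)

lemma type2_sub: "type2 G r \<sigma> \<Longrightarrow> \<sigma> \<subseteq> G"
  using type2_pot pot_type2_sub by blast

lemma sum_rk_remove_less:
  assumes "\<sigma> \<subseteq> G" "m \<in> \<sigma>" "b \<in> \<sigma>" "rk b < rk m"
  shows "sum rk (\<sigma> - {m}) < sum rk (\<sigma> - {b})"
  using sum.remove[OF finite_sub[OF assms(1)] assms(2), of rk]
    sum.remove[OF finite_sub[OF assms(1)] assms(3), of rk] assms(4) by simp

lemma edge_props:
  assumes \<sigma>: "\<sigma> \<subseteq> G" and e: "edge \<sigma> \<tau>"
  shows "\<tau> \<subseteq> G \<and> (\<tau>, \<sigma>) \<in> descent \<and> level \<tau> \<le> level \<sigma> \<and> mon_dvd (mon_lcm \<tau>) (mon_lcm \<sigma>)"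
proof (cases "(\<tau>, \<sigma>) \<in> bm_matching G r")
  case True
  then have t: "type2 G r \<tau>" and s: "\<sigma> = mate \<tau>" by (auto simp: mem_bm_matching_iff)
  have "mon_lcm \<sigma> = mon_lcm \<tau>" using mon_lcm_mate[OF type2_pot[OF t]] s by simp
  moreover have "card \<tau> = Suc (card \<sigma>)" using card_mate[OF t] s by simp
  moreover have "\<not> type2 G r \<sigma>" using mate_not_type2[OF t] s by simp
  ultimately show ?thesis
    using t s type2_sub[OF t] by (simp add: descent_def level_def)
next
  case False
  then obtain m where m: "m \<in> \<sigma>" "\<tau> = \<sigma> - {m}" and nA: "\<not> (type2 G r \<sigma> \<and> \<tau> = mate \<sigma>)"
    using e by (auto simp: morse_edge_def facet_def mem_bm_matching_iff)
  have \<tau>: "\<tau> \<subseteq> G" using \<sigma> m by auto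
  have card: "card \<sigma> = Suc (card \<tau>)" using m finite_sub[OF \<sigma>] by (metis card_Suc_Diff1)
  have dvd: "mon_dvd (mon_lcm \<tau>) (mon_lcm \<sigma>)"
    using m finite_sub[OF \<sigma>] by (intro mon_lcm_mono) auto
  have lev: "level \<tau> \<le> level \<sigma>" using card by (auto simp: level_def)
  have "(\<tau>, \<sigma>) \<in> descent"
  proof (cases "level \<tau> = level \<sigma>")
    case False
    then show ?thesis using lev by (simp add: descent_def)
  next
    case same: True
    then have t: "type2 G r \<sigma>" "\<not> type2 G r \<tau>"
      using card card_mate[of \<tau>] by (auto simp: level_def split: if_splits)
    show ?thesis
    proof (cases "mon_lcm \<tau> = mon_lcm \<sigma>")
      case False
      then show ?thesis
        using mon_deg_less[OF dvd] same by (simp add: descent_def)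
    next
      case eq: True
      then have "bridge \<sigma> m" using m by (simp add: bridge_def)
      then have "rk (sb r \<sigma>) \<le> rk m" using sb_bridge_least(2) \<sigma> by blast
      moreover have "sb r \<sigma> \<in> \<sigma>" using bridge_mem pot_type2_sb type2_pot t(1) by blast
      moreover have "m \<noteq> sb r \<sigma>" using nA t m by auto
      ultimately have "sum rk \<tau> < sum rk (mate \<sigma>)"
        unfolding m(2) using sum_rk_remove_less[OF \<sigma> m(1)] rk_inj[of m "sb r \<sigma>"] m(1) \<sigma>
        by (metis order.not_eq_order_implies_strict subsetD)
      then show ?thesis using same eq t by (simp add: descent_def)
    qed
  qed
  then show ?thesis using \<tau> lev dvd by blast
qed

lemma finite_successors: "\<sigma> \<subseteq> G \<Longrightarrow> finite {\<rho>. edge \<sigma> \<rho>}"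
  by (rule finite_subset[of _ "Pow G"]) (use edge_props finite_G in auto)

lemma walk_props:
  assumes "p \<noteq> []" "hd p \<subseteq> G" "successively edge p" "x \<in> set p"
  shows "x \<subseteq> G \<and> (x, hd p) \<in> descent\<^sup>* \<and> level x \<le> level (hd p) \<and>
    mon_dvd (mon_lcm x) (mon_lcm (hd p))"
  using assms
proof (induction p)
  case (Cons \<sigma> q)
  show ?case
  proof (cases "x = \<sigma>")
    case False
    then have q: "q \<noteq> []" "x \<in> set q" using Cons.prems by auto
    then have e: "edge \<sigma> (hd q)" "successively edge q"
      using Cons.prems by (auto simp: successively_Cons)
    have \<sigma>: "\<sigma> \<subseteq> G" using Cons.prems by simp
    note step = edge_props[OF \<sigma> e(1)]
    note IH = Cons.IH[OF q(1) _ e(2) q(2)]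
    show ?thesis
      using step IH by (auto intro: mon_dvd_trans rtrancl_into_rtrancl)
  qed (use Cons.prems in auto)
qed simp

lemma finite_gradient_paths:
  assumes "\<sigma> \<subseteq> G"
  shows "finite (gradient_paths (bm_matching G r) \<sigma> \<tau>)"
proof (rule finite_subset)
  show "gradient_paths (bm_matching G r) \<sigma> \<tau> \<subseteq> {p. set p \<subseteq> Pow G \<and> distinct p}"
    unfolding gradient_paths_def using walk_props assms by blast
  show "finite {p. set p \<subseteq> Pow G \<and> distinct p}"
    using finite_G by (intro finite_subset_distinct) auto
qed

lemma gradient_paths_refl: "gradient_paths A \<sigma> \<sigma> = {[\<sigma>]}"
proof (rule set_eqI)
  fix p
  show "p \<in> gradient_paths A \<sigma> \<sigma> \<longleftrightarrow> p \<in> {[\<sigma>]}"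
  proof (cases p)
    case (Cons a q)
    then show ?thesis
      unfolding gradient_paths_def by (cases "q = []") auto
  qed (simp add: gradient_paths_def)
qed

text \<open>
  Prepending a vertex to a gradient path keeps its vertices distinct because the graph is acyclic.
\<close>

lemma gradient_paths_step:
  assumes \<sigma>: "\<sigma> \<subseteq> G" and ne: "\<sigma> \<noteq> \<tau>"
  shows "gradient_paths (bm_matching G r) \<sigma> \<tau> =
    (\<Union>\<rho>\<in>{\<rho>. edge \<sigma> \<rho>}. (#) \<sigma> ` gradient_paths (bm_matching G r) \<rho> \<tau>)"
proof (intro set_eqI iffI)
  fix p
  assume p: "p \<in> gradient_paths (bm_matching G r) \<sigma> \<tau>"
  then obtain q where q: "p = \<sigma> # q" by (cases p) (auto simp: gradient_paths_def)
  then have "q \<noteq> []" using p ne by (auto simp: gradient_paths_def)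
  then have "edge \<sigma> (hd q)" "q \<in> gradient_paths (bm_matching G r) (hd q) \<tau>"
    using p q by (auto simp: gradient_paths_def successively_Cons)
  then show "p \<in> (\<Union>\<rho>\<in>{\<rho>. edge \<sigma> \<rho>}. (#) \<sigma> ` gradient_paths (bm_matching G r) \<rho> \<tau>)"
    using q by blast
next
  fix p
  assume "p \<in> (\<Union>\<rho>\<in>{\<rho>. edge \<sigma> \<rho>}. (#) \<sigma> ` gradient_paths (bm_matching G r) \<rho> \<tau>)"
  then obtain \<rho> q where e: "edge \<sigma> \<rho>" and q: "q \<in> gradient_paths (bm_matching G r) \<rho> \<tau>"
      and p: "p = \<sigma> # q" by blast
  have q': "q \<noteq> []" "hd q = \<rho>" "last q = \<tau>" "distinct q" "successively edge q"
    using q by (auto simp: gradient_paths_def)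
  have \<rho>: "\<rho> \<subseteq> G" "(\<rho>, \<sigma>) \<in> descent" using edge_props[OF \<sigma> e] by auto
  have "\<sigma> \<notin> set q"
  proof
    assume "\<sigma> \<in> set q"
    then have "(\<sigma>, \<rho>) \<in> descent\<^sup>*"
      using walk_props[OF q'(1) _ q'(5)] q'(2) \<rho>(1) by auto
    then have "(\<sigma>, \<sigma>) \<in> descent\<^sup>+" using \<rho>(2) by (rule rtrancl_into_trancl1)
    then show False using wf_trancl[OF wf_descent] by auto
  qed
  then show "p \<in> gradient_paths (bm_matching G r) \<sigma> \<tau>"
    unfolding gradient_paths_def p using q' e by (auto simp: successively_Cons)
qed

text \<open>
  The total weight of the gradient paths from \<open>\<sigma>\<close> to \<open>\<tau>\<close>.  For critical \<open>\<tau>\<close> and sets of the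
  same cardinality this will be the matrix of the projection from the Taylor complex onto the
  critical sets; the next lemmas establish its defining properties.
\<close>

definition path_sum :: "'v mon set \<Rightarrow> 'v mon set \<Rightarrow> 'k::field" where
  "path_sum \<sigma> \<tau> = (\<Sum>p\<in>gradient_paths (bm_matching G r) \<sigma> \<tau>. path_weight (bm_matching G r) r p)"

lemma path_sum_refl: "path_sum \<sigma> \<sigma> = 1"
  by (simp add: path_sum_def gradient_paths_refl path_weight_def)

lemma path_weight_Cons:
  "q \<noteq> [] \<Longrightarrow> path_weight A r (\<sigma> # q) = edge_weight A r \<sigma> (hd q) * path_weight A r q"
  by (cases q) (auto simp: path_weight_def)

lemma path_sum_step:
  assumes \<sigma>: "\<sigma> \<subseteq> G" and ne: "\<sigma> \<noteq> \<tau>"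
  shows "path_sum \<sigma> \<tau> =
    (\<Sum>\<rho> | edge \<sigma> \<rho>. edge_weight (bm_matching G r) r \<sigma> \<rho> * path_sum \<rho> \<tau> :: 'k::field)"
proof -
  let ?A = "bm_matching G r"
  have "path_sum \<sigma> \<tau> =
      (\<Sum>\<rho> | edge \<sigma> \<rho>. sum (path_weight ?A r) ((#) \<sigma> ` gradient_paths ?A \<rho> \<tau>) :: 'k)"
    unfolding path_sum_def gradient_paths_step[OF assms]
  proof (rule sum.UNION_disjoint)
    show "finite {\<rho>. edge \<sigma> \<rho>}" by (rule finite_successors[OF \<sigma>])
    show "\<forall>\<rho>\<in>{\<rho>. edge \<sigma> \<rho>}. finite ((#) \<sigma> ` gradient_paths ?A \<rho> \<tau>)"
      using edge_props[OF \<sigma>] finite_gradient_paths by blast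
    show "\<forall>\<rho>\<in>{\<rho>. edge \<sigma> \<rho>}. \<forall>\<rho>'\<in>{\<rho>. edge \<sigma> \<rho>}. \<rho> \<noteq> \<rho>' \<longrightarrow>
        (#) \<sigma> ` gradient_paths ?A \<rho> \<tau> \<inter> (#) \<sigma> ` gradient_paths ?A \<rho>' \<tau> = {}"
      by (auto simp: gradient_paths_def)
  qed
  also have "\<dots> = (\<Sum>\<rho> | edge \<sigma> \<rho>. edge_weight ?A r \<sigma> \<rho> * path_sum \<rho> \<tau>)"
  proof (rule sum.cong[OF refl])
    fix \<rho>
    have "sum (path_weight ?A r) ((#) \<sigma> ` gradient_paths ?A \<rho> \<tau>) =
        (\<Sum>q\<in>gradient_paths ?A \<rho> \<tau>. path_weight ?A r (\<sigma> # q) :: 'k)"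
      by (subst sum.reindex) (auto simp: inj_on_def)
    also have "\<dots> = (\<Sum>q\<in>gradient_paths ?A \<rho> \<tau>. edge_weight ?A r \<sigma> \<rho> * path_weight ?A r q)"
      by (intro sum.cong refl, subst path_weight_Cons) (auto simp: gradient_paths_def)
    finally show "sum (path_weight ?A r) ((#) \<sigma> ` gradient_paths ?A \<rho> \<tau>) =
        (edge_weight ?A r \<sigma> \<rho> * path_sum \<rho> \<tau> :: 'k)"
      by (simp add: path_sum_def sum_distrib_left)
  qed
  finally show ?thesis .
qed

lemma path_sum_nonzeroD:
  assumes "\<sigma> \<subseteq> G" "path_sum \<sigma> \<tau> \<noteq> (0 :: 'k::field)"
  shows "level \<tau> \<le> level \<sigma>" "mon_dvd (mon_lcm \<tau>) (mon_lcm \<sigma>)" "\<tau> \<subseteq> G"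
proof -
  have "gradient_paths (bm_matching G r) \<sigma> \<tau> \<noteq> {}"
    using assms(2) by (auto simp: path_sum_def)
  then obtain p where p: "p \<noteq> []" "hd p = \<sigma>" "last p = \<tau>" "successively edge p"
    by (auto simp: gradient_paths_def)
  have "\<tau> \<in> set p" using p last_in_set by blast
  then show "level \<tau> \<le> level \<sigma>" "mon_dvd (mon_lcm \<tau>) (mon_lcm \<sigma>)" "\<tau> \<subseteq> G"
    using walk_props[OF p(1) _ p(4)] p(2) assms(1) by auto
qed

lemma path_sum_zero_level: "\<sigma> \<subseteq> G \<Longrightarrow> level \<sigma> < level \<tau> \<Longrightarrow> path_sum \<sigma> \<tau> = (0 :: 'k::field)"
  using path_sum_nonzeroD(1) leD by blast

lemma level_critical: "critical G r \<tau> \<Longrightarrow> level \<tau> = card \<tau>"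
  by (simp add: critical_iff level_def)

lemma level_le_card: "level \<sigma> \<le> card \<sigma>"
  by (simp add: level_def)

lemma card_facet: "\<sigma> \<subseteq> G \<Longrightarrow> facet \<sigma> \<rho> \<Longrightarrow> card \<sigma> = Suc (card \<rho>)"
  unfolding facet_def using finite_sub by (metis card_Suc_Diff1)

lemma facet_sub: "facet \<sigma> \<rho> \<Longrightarrow> \<rho> \<subseteq> \<sigma>"
  by (auto simp: facet_def)

lemma path_sum_critical:
  assumes \<kappa>: "critical G r \<kappa>" and \<tau>: "critical G r \<tau>" and card: "card \<kappa> = card \<tau>"
  shows "path_sum \<kappa> \<tau> = (if \<kappa> = \<tau> then 1 else 0)"
proof (cases "\<kappa> = \<tau>")
  case False
  have \<kappa>G: "\<kappa> \<subseteq> G" using \<kappa> by (simp add: critical_iff)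
  have "path_sum \<rho> \<tau> = (0 :: 'a)" if e: "edge \<kappa> \<rho>" for \<rho>
  proof -
    have "(\<rho>, \<kappa>) \<notin> bm_matching G r" using \<kappa> by (auto simp: critical_iff mem_bm_matching_iff)
    then have "facet \<kappa> \<rho>" using e by (auto simp: morse_edge_def)
    then have "level \<rho> < level \<tau>"
      using card_facet[OF \<kappa>G] card level_le_card[of \<rho>] level_critical[OF \<tau>] by simp
    then show ?thesis using path_sum_zero_level edge_props[OF \<kappa>G e] by blast
  qed
  then show ?thesis using False by (simp add: path_sum_step[OF \<kappa>G False])
qed (simp add: path_sum_refl)

lemma path_sum_type2:
  assumes "type2 G r \<sigma>" "critical G r \<tau>" "card \<sigma> = card \<tau>"
  shows "path_sum \<sigma> \<tau> = 0"
  using assms card_mate[OF assms(1)]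
  by (intro path_sum_zero_level type2_sub) (auto simp: level_critical, auto simp: level_def)

lemma incidence_square: "facet \<sigma> \<rho> \<Longrightarrow> incidence r \<sigma> \<rho> * incidence r \<sigma> \<rho> = (1 :: 'k::field)"
  by (simp add: incidence_def flip: power_mult_distrib)

lemma facet_mate: "type2 G r \<sigma> \<Longrightarrow> facet \<sigma> (mate \<sigma>)"
  unfolding facet_def using bridge_mem pot_type2_sb type2_pot by blast

text \<open>
  The projection kills the boundary of a type-2 set \<open>\<sigma>\<close>: a path that starts at the mate of \<open>\<sigma>\<close>
  and ends at the same cardinality has to go up to \<open>\<sigma>\<close> first and then down to another facet.
\<close>

lemma path_sum_boundary_type2:
  assumes \<sigma>: "type2 G r \<sigma>" and \<tau>: "critical G r \<tau>" and card: "card \<sigma> = Suc (card \<tau>)"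
  shows "(\<Sum>\<rho> | facet \<sigma> \<rho>. incidence r \<sigma> \<rho> * path_sum \<rho> \<tau>) = (0 :: 'k::field)"
proof -
  let ?A = "bm_matching G r" and ?\<rho> = "mate \<sigma>"
  have \<sigma>G: "\<sigma> \<subseteq> G" and \<rho>G: "?\<rho> \<subseteq> G" using type2_sub[OF \<sigma>] by auto
  have ne: "\<sigma> \<noteq> \<tau>" "?\<rho> \<noteq> \<tau>" using \<sigma> \<tau> by (auto simp: critical_iff)
  have fin: "finite {\<rho>. facet \<sigma> \<rho>}"
    by (rule finite_subset[of _ "Pow \<sigma>"]) (use finite_sub[OF \<sigma>G] facet_sub in auto)
  have mA: "(\<sigma>, ?\<rho>) \<in> ?A" using \<sigma> by (simp add: mem_bm_matching_iff)
  have no_up: "(\<rho>, \<sigma>) \<notin> ?A" for \<rho>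
    using mate_not_type2 \<sigma> by (auto simp: mem_bm_matching_iff)
  have succ_\<sigma>: "{\<rho>. edge \<sigma> \<rho>} = {\<rho>. facet \<sigma> \<rho>} - {?\<rho>}"
    using no_up \<sigma> by (auto simp: morse_edge_def mem_bm_matching_iff)
  have down: "path_sum \<sigma> \<tau> = (\<Sum>\<rho>\<in>{\<rho>. facet \<sigma> \<rho>} - {?\<rho>}. incidence r \<sigma> \<rho> * path_sum \<rho> \<tau> :: 'k)"
    unfolding path_sum_step[OF \<sigma>G ne(1)] succ_\<sigma>
    using no_up by (intro sum.cong) (auto simp: edge_weight_def)
  have others: "path_sum \<rho> \<tau> = (0 :: 'k)" if e: "edge ?\<rho> \<rho>" "\<rho> \<noteq> \<sigma>" for \<rho>
  proof -
    have "(\<rho>, ?\<rho>) \<notin> ?A"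
      using e(2) \<sigma> mate_inj[of \<rho> \<sigma>] by (auto simp: mem_bm_matching_iff)
    then have "facet ?\<rho> \<rho>" using e by (auto simp: morse_edge_def)
    then have "level \<rho> < level \<tau>"
      using card_facet[OF \<rho>G] card card_mate[OF \<sigma>] level_le_card[of \<rho>] level_critical[OF \<tau>]
      by simp
    then show ?thesis using path_sum_zero_level edge_props[OF \<rho>G e(1)] by blast
  qed
  have "path_sum ?\<rho> \<tau> = edge_weight ?A r ?\<rho> \<sigma> * (path_sum \<sigma> \<tau> :: 'k)"
  proof -
    have "(\<Sum>\<rho>\<in>{\<sigma>}. edge_weight ?A r ?\<rho> \<rho> * path_sum \<rho> \<tau>) =
        (\<Sum>\<rho> | edge ?\<rho> \<rho>. edge_weight ?A r ?\<rho> \<rho> * path_sum \<rho> \<tau> :: 'k)"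
      using mA others
      by (intro sum.mono_neutral_left finite_successors[OF \<rho>G]) (auto simp: morse_edge_def)
    then show ?thesis unfolding path_sum_step[OF \<rho>G ne(2)] by simp
  qed
  then have up: "path_sum ?\<rho> \<tau> = - incidence r \<sigma> ?\<rho> * (path_sum \<sigma> \<tau> :: 'k)"
    using mA by (simp add: edge_weight_def)
  have "(\<Sum>\<rho> | facet \<sigma> \<rho>. incidence r \<sigma> \<rho> * path_sum \<rho> \<tau>) =
      incidence r \<sigma> ?\<rho> * path_sum ?\<rho> \<tau> + (path_sum \<sigma> \<tau> :: 'k)"
    unfolding down using sum.remove[OF fin, of ?\<rho>] facet_mate[OF \<sigma>] by simp
  also have "\<dots> = 0"
    unfolding up using incidence_square[OF facet_mate[OF \<sigma>], where 'k = 'k]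
    by (simp flip: mult.assoc)
  finally show ?thesis .
qed

end


section \<open>Algebraic discrete Morse theory\<close>

text \<open>
  A finite complex of vector spaces with basis \<open>X\<close> and boundary matrix \<open>inc\<close>.  The cells in \<open>U\<close>
  are matched with those in \<open>mate ` U\<close>, the cells in \<open>K\<close> are critical, and \<open>P\<close> is the matrix of
  a projection onto the span of \<open>K\<close> that vanishes on \<open>U\<close> and on the boundaries of the cells in
  \<open>U\<close>.  Acyclicity of the matching is the existence of the well-founded relation \<open>R\<close>.
\<close>

locale morse_reduction =
  fixes X U K :: "'c set" and mate :: "'c \<Rightarrow> 'c" and R :: "('c \<times> 'c) set"
    and inc P :: "'c \<Rightarrow> 'c \<Rightarrow> 'k::field"
  assumes finite_X: "finite X" and U_sub: "U \<subseteq> X" and K_sub: "K \<subseteq> X"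
    and cover: "x \<in> X \<Longrightarrow> x \<in> K \<or> x \<in> U \<or> x \<in> mate ` U"
    and mate_mem: "\<sigma> \<in> U \<Longrightarrow> mate \<sigma> \<in> X"
    and unit: "\<sigma> \<in> U \<Longrightarrow> inc \<sigma> (mate \<sigma>) \<noteq> 0"
    and wf_R: "wf R"
    and acyclic: "\<sigma> \<in> U \<Longrightarrow> \<sigma>' \<in> U \<Longrightarrow> \<sigma> \<noteq> \<sigma>' \<Longrightarrow> inc \<sigma> (mate \<sigma>') \<noteq> 0 \<Longrightarrow> (\<sigma>', \<sigma>) \<in> R"
    and square: "x \<in> X \<Longrightarrow> z \<in> X \<Longrightarrow> (\<Sum>y\<in>X. inc x y * inc y z) = 0"
    and P_outside: "\<tau> \<notin> K \<Longrightarrow> P \<rho> \<tau> = 0"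
    and P_critical: "\<kappa> \<in> K \<Longrightarrow> \<tau> \<in> K \<Longrightarrow> P \<kappa> \<tau> = (if \<kappa> = \<tau> then 1 else 0)"
    and P_upper: "\<sigma> \<in> U \<Longrightarrow> \<tau> \<in> K \<Longrightarrow> P \<sigma> \<tau> = 0"
    and P_boundary: "\<sigma> \<in> U \<Longrightarrow> \<tau> \<in> K \<Longrightarrow> (\<Sum>\<rho>\<in>X. inc \<sigma> \<rho> * P \<rho> \<tau>) = 0"
begin

text \<open>Chains are row vectors, on which matrices act from the right.\<close>

definition appl :: "('c \<Rightarrow> 'c \<Rightarrow> 'k) \<Rightarrow> ('c \<Rightarrow> 'k) \<Rightarrow> 'c \<Rightarrow> 'k" where
  "appl M f \<tau> = (\<Sum>\<sigma>\<in>X. f \<sigma> * M \<sigma> \<tau>)"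

abbreviation "bd \<equiv> appl inc"
abbreviation "pr \<equiv> appl P"

lemma appl_add: "appl M (\<lambda>x. f x + g x) \<tau> = appl M f \<tau> + appl M g \<tau>"
  by (simp add: appl_def distrib_right sum.distrib)

lemma appl_diff: "appl M (\<lambda>x. f x - g x) \<tau> = appl M f \<tau> - appl M g \<tau>"
  by (simp add: appl_def left_diff_distrib sum_subtractf)

lemma appl_cong: "(\<And>x. x \<in> X \<Longrightarrow> f x = g x) \<Longrightarrow> appl M f \<tau> = appl M g \<tau>"
  by (simp add: appl_def)

lemma appl_appl: "appl N (appl M f) \<tau> = (\<Sum>\<sigma>\<in>X. f \<sigma> * (\<Sum>x\<in>X. M \<sigma> x * N x \<tau>))"
  unfolding appl_def sum_distrib_left sum_distrib_right mult.assoc by (rule sum.swap)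

lemma bd_bd: "z \<in> X \<Longrightarrow> bd (bd f) z = 0"
  by (simp add: appl_appl square)

text \<open>\<open>f\<close> vanishes outside \<open>A\<close>.\<close>

definition supp_in :: "'c set \<Rightarrow> ('c \<Rightarrow> 'k) \<Rightarrow> bool" where
  "supp_in A f \<longleftrightarrow> (\<forall>x. x \<notin> A \<longrightarrow> f x = 0)"

lemma pr_upper: "supp_in U u \<Longrightarrow> pr u \<tau> = 0"
  unfolding appl_def supp_in_def
  by (intro sum.neutral) (metis P_outside P_upper mult_eq_0_iff)

lemma pr_bd_upper: "supp_in U u \<Longrightarrow> pr (bd u) \<tau> = 0"
  unfolding appl_appl supp_in_def
proof (intro sum.neutral ballI)
  fix \<sigma>
  assume u: "\<forall>x. x \<notin> U \<longrightarrow> u x = 0"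
  show "u \<sigma> * (\<Sum>x\<in>X. inc \<sigma> x * P x \<tau>) = 0"
    using u P_boundary[of \<sigma> \<tau>] P_outside[of \<tau>] by (cases "\<sigma> \<in> U"; cases "\<tau> \<in> K") auto
qed

lemma pr_critical: "supp_in K f \<Longrightarrow> \<tau> \<in> K \<Longrightarrow> pr f \<tau> = f \<tau>"
proof -
  assume f: "supp_in K f" and \<tau>: "\<tau> \<in> K"
  have "pr f \<tau> = (\<Sum>\<sigma>\<in>X. if \<sigma> = \<tau> then f \<tau> else 0)"
    unfolding appl_def
  proof (rule sum.cong[OF refl])
    fix \<sigma>
    show "f \<sigma> * P \<sigma> \<tau> = (if \<sigma> = \<tau> then f \<tau> else 0)"
      using f \<tau> P_critical[of \<sigma> \<tau>] by (cases "\<sigma> \<in> K") (auto simp: supp_in_def)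
  qed
  then show ?thesis using finite_X K_sub \<tau> by auto
qed

lemma supp_pr: "supp_in K (pr f)"
  by (simp add: supp_in_def appl_def P_outside)

text \<open>The subcomplex spanned by the cells in \<open>U\<close> and their boundaries; it is the kernel of \<open>P\<close>.\<close>

definition null :: "('c \<Rightarrow> 'k) \<Rightarrow> bool" where
  "null f \<longleftrightarrow> (\<exists>u u'. supp_in U u \<and> supp_in U u' \<and> (\<forall>x\<in>X. f x = u x + bd u' x))"

lemma null_cong: "null f \<Longrightarrow> (\<And>x. x \<in> X \<Longrightarrow> f x = g x) \<Longrightarrow> null g"
  unfolding null_def by auto

lemma null_zero: "null (\<lambda>_. 0)"
  unfolding null_def by (intro exI[of _ "\<lambda>_. 0"]) (simp add: supp_in_def appl_def)

lemma null_add: "null f \<Longrightarrow> null g \<Longrightarrow> null (\<lambda>x. f x + g x)"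
proof -
  assume "null f" "null g"
  then obtain u u' v v' where
    "supp_in U u" "supp_in U u'" "\<forall>x\<in>X. f x = u x + bd u' x"
    "supp_in U v" "supp_in U v'" "\<forall>x\<in>X. g x = v x + bd v' x"
    unfolding null_def by blast
  then show ?thesis
    unfolding null_def
    by (intro exI[of _ "\<lambda>x. u x + v x"] exI[of _ "\<lambda>x. u' x + v' x"])
      (auto simp: supp_in_def appl_add)
qed

lemma null_scale: "null f \<Longrightarrow> null (\<lambda>x. c * f x)"
proof -
  assume "null f"
  then obtain u u' where
    "supp_in U u" "supp_in U u'" "\<forall>x\<in>X. f x = u x + bd u' x"
    unfolding null_def by blast
  then show ?thesis
    unfolding null_def
    by (intro exI[of _ "\<lambda>x. c * u x"] exI[of _ "\<lambda>x. c * u' x"])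
      (auto simp: supp_in_def appl_def distrib_left sum_distrib_left mult.assoc)
qed

lemma null_sum: "finite A \<Longrightarrow> (\<And>i. i \<in> A \<Longrightarrow> null (f i)) \<Longrightarrow> null (\<lambda>x. \<Sum>i\<in>A. f i x)"
  by (induction A rule: finite_induct) (simp_all add: null_zero null_add)

lemma null_bd_cell:
  assumes "\<sigma> \<in> U"
  shows "null (inc \<sigma>)"
proof -
  have "bd (\<lambda>x. if x = \<sigma> then 1 else 0) y = inc \<sigma> y" for y
  proof -
    have "bd (\<lambda>x. if x = \<sigma> then 1 else 0) y = (\<Sum>x\<in>X. if x = \<sigma> then inc \<sigma> y else 0)"
      unfolding appl_def by (intro sum.cong) auto
    then show ?thesis using finite_X U_sub assms by auto
  qed
  then show ?thesis
    unfolding null_def using assms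
    by (intro exI[of _ "\<lambda>_. 0"] exI[of _ "\<lambda>x. if x = \<sigma> then 1 else 0"]) (auto simp: supp_in_def)
qed

text \<open>
  For a cell of \<open>mate ` U\<close> this is an induction along \<open>R\<close>: modulo the boundary of the matched
  cell \<open>\<sigma>\<close>, the mate of \<open>\<sigma>\<close> is a combination of the other cells in that boundary.
\<close>

lemma null_cell_minus_P:
  assumes "\<rho> \<in> X"
  shows "null (\<lambda>x. (if x = \<rho> then 1 else 0) - P \<rho> x)"
proof -
  have KU: "null (\<lambda>x. (if x = \<rho> then 1 else 0) - P \<rho> x)" if "\<rho> \<in> K \<or> \<rho> \<in> U" for \<rho>
  proof (cases "\<rho> \<in> K")
    case True
    then have "(if x = \<rho> then 1 else 0) - P \<rho> x = 0" for x
      using P_critical[OF True, of x] P_outside[of x \<rho>] True by (cases "x \<in> K") auto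
    then show ?thesis by (simp add: null_zero)
  next
    case False
    then have U: "\<rho> \<in> U" using that by blast
    have "P \<rho> x = 0" for x using P_upper[OF U, of x] P_outside[of x \<rho>] by blast
    then show ?thesis
      unfolding null_def using U
      by (intro exI[of _ "\<lambda>x. if x = \<rho> then 1 else 0"] exI[of _ "\<lambda>_. 0"])
        (auto simp: supp_in_def appl_def)
  qed
  have lower: "null (\<lambda>x. (if x = mate \<sigma> then 1 else 0) - P (mate \<sigma>) x)" if "\<sigma> \<in> U" for \<sigma>
    using wf_R that
  proof (induction \<sigma> rule: wf_induct_rule)
    case (less \<sigma>)
    let ?\<rho> = "mate \<sigma>" and ?g = "\<lambda>y x. (if x = y then 1 else 0) - P y x"
    have others: "null (\<lambda>x. inc \<sigma> y * ?g y x)" if y: "y \<in> X - {?\<rho>}" for y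
    proof (cases "inc \<sigma> y = 0")
      case False
      have "null (?g y)"
        using cover[of y] KU[of y] less.IH acyclic[OF less.prems] y False less.prems by blast
      then show ?thesis by (rule null_scale)
    qed (simp add: null_zero)
    have "null (\<lambda>x. \<Sum>y\<in>X - {?\<rho>}. inc \<sigma> y * ?g y x)"
      using finite_X others by (intro null_sum) auto
    then have *: "null (\<lambda>x. inverse (inc \<sigma> ?\<rho>) *
        (inc \<sigma> x + (-1) * (\<Sum>y\<in>X - {?\<rho>}. inc \<sigma> y * ?g y x)))"
      by (intro null_scale null_add null_bd_cell less.prems)
    show ?case
    proof (rule null_cong[OF *])
      fix x
      assume x: "x \<in> X"
      have "(\<Sum>y\<in>X. inc \<sigma> y * P y x) = 0"
        using P_boundary[OF less.prems, of x] P_outside[of x] by (cases "x \<in> K") auto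
      moreover have "(\<Sum>y\<in>X. inc \<sigma> y * (if x = y then 1 else 0)) = inc \<sigma> x"
        using finite_X x by (simp add: if_distrib cong: if_cong)
      ultimately have "(\<Sum>y\<in>X. inc \<sigma> y * ?g y x) = inc \<sigma> x"
        by (simp add: right_diff_distrib sum_subtractf)
      then have split: "inc \<sigma> x = inc \<sigma> ?\<rho> * ?g ?\<rho> x + (\<Sum>y\<in>X - {?\<rho>}. inc \<sigma> y * ?g y x)"
        using sum.remove[OF finite_X mate_mem[OF less.prems], of "\<lambda>y. inc \<sigma> y * ?g y x"]
        by (simp only:)
      have "inc \<sigma> x + (-1) * (\<Sum>y\<in>X - {?\<rho>}. inc \<sigma> y * ?g y x) = inc \<sigma> ?\<rho> * ?g ?\<rho> x"
        by (subst split) (simp only: mult_minus1 add_uminus_conv_diff add_diff_cancel_right')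
      then show "inverse (inc \<sigma> ?\<rho>) * (inc \<sigma> x + (-1) * (\<Sum>y\<in>X - {?\<rho>}. inc \<sigma> y * ?g y x)) = ?g ?\<rho> x"
        using unit[OF less.prems] by (simp add: field_simps)
    qed
  qed
  show ?thesis using cover[OF assms] KU[of \<rho>] lower by blast
qed

lemma null_minus_pr: "null (\<lambda>x. f x - pr f x)"
proof -
  have "null (\<lambda>x. \<Sum>\<rho>\<in>X. f \<rho> * ((if x = \<rho> then 1 else 0) - P \<rho> x))"
    using finite_X by (intro null_sum null_scale null_cell_minus_P)
  then show ?thesis
  proof (rule null_cong)
    fix x
    assume "x \<in> X"
    then have "(\<Sum>\<rho>\<in>X. f \<rho> * (if x = \<rho> then 1 else 0)) = f x"
      using finite_X by (simp add: if_distrib cong: if_cong)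
    then show "(\<Sum>\<rho>\<in>X. f \<rho> * ((if x = \<rho> then 1 else 0) - P \<rho> x)) = f x - pr f x"
      by (simp add: appl_def right_diff_distrib sum_subtractf)
  qed
qed

lemma pr_bd_null:
  assumes "null f"
  shows "pr (bd f) \<tau> = 0"
proof -
  obtain u u' where u: "supp_in U u" "supp_in U u'" "\<forall>x\<in>X. f x = u x + bd u' x"
    using assms unfolding null_def by blast
  have "bd f x = bd u x" if "x \<in> X" for x
  proof -
    have "bd f x = bd (\<lambda>x. u x + bd u' x) x" using u(3) by (intro appl_cong) auto
    then show ?thesis by (simp add: appl_add bd_bd[OF that])
  qed
  then have "pr (bd f) \<tau> = pr (bd u) \<tau>" by (rule appl_cong)
  then show ?thesis using pr_bd_upper u(1) by simp
qed

text \<open>\<open>P\<close> is a chain map to the Morse complex, whose boundary is \<open>pr \<circ> bd\<close>.\<close>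

lemma pr_bd_pr: "pr (bd (pr f)) \<tau> = pr (bd f) \<tau>"
proof -
  have "pr (bd (\<lambda>x. f x - pr f x)) \<tau> = pr (bd f) \<tau> - pr (bd (pr f)) \<tau>"
    by (subst appl_diff[symmetric], rule appl_cong) (rule appl_diff)
  then show ?thesis using pr_bd_null[OF null_minus_pr, of f \<tau>] by simp
qed

lemma morse_boundary_square: "pr (bd (pr (bd f))) \<tau> = 0"
proof -
  have "pr (bd (bd f)) \<tau> = pr (\<lambda>_. 0) \<tau>" by (rule appl_cong) (rule bd_bd)
  then show ?thesis by (simp add: pr_bd_pr) (simp add: appl_def)
qed

text \<open>
  The boundary is injective on chains supported on \<open>U\<close>: at the mate of a maximal cell of the
  support, only that cell contributes.
\<close>

lemma bd_upper_inj:
  assumes u: "supp_in U u" and zero: "\<And>x. x \<in> X \<Longrightarrow> bd u x = 0"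
  shows "u \<sigma> = 0"
proof (rule ccontr)
  assume \<sigma>: "u \<sigma> \<noteq> 0"
  let ?S = "{\<sigma>. u \<sigma> \<noteq> 0}"
  have SU: "?S \<subseteq> U" using u by (auto simp: supp_in_def)
  then have fin: "finite ?S" using finite_subset[OF U_sub finite_X] finite_subset[of ?S U] by simp
  have "wf ((R \<inter> ?S \<times> ?S)\<inverse>)"
  proof (rule finite_acyclic_wf_converse)
    show "finite (R \<inter> ?S \<times> ?S)" using fin by blast
    show "Transitive_Closure.acyclic (R \<inter> ?S \<times> ?S)"
      using wf_R wf_acyclic by (metis acyclic_subset inf_le1)
  qed
  then obtain \<mu> where \<mu>: "\<mu> \<in> ?S" and max: "\<And>\<nu>. (\<nu>, \<mu>) \<in> (R \<inter> ?S \<times> ?S)\<inverse> \<Longrightarrow> \<nu> \<notin> ?S"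
    using \<sigma> wfE_min[of _ \<sigma> ?S] by (metis (mono_tags, lifting) mem_Collect_eq)
  have \<mu>U: "\<mu> \<in> U" using \<mu> SU by blast
  have "u \<nu> * inc \<nu> (mate \<mu>) = 0" if "\<nu> \<noteq> \<mu>" for \<nu>
  proof (rule ccontr)
    assume *: "u \<nu> * inc \<nu> (mate \<mu>) \<noteq> 0"
    then have "\<nu> \<in> ?S" "\<nu> \<in> U" using SU by auto
    then have "(\<mu>, \<nu>) \<in> R" using acyclic[of \<nu> \<mu>] that * \<mu>U by auto
    then show False using max[of \<nu>] \<open>\<nu> \<in> ?S\<close> \<mu> by blast
  qed
  then have "(\<Sum>\<nu>\<in>X - {\<mu>}. u \<nu> * inc \<nu> (mate \<mu>)) = 0"
    by (intro sum.neutral) blast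
  then have "bd u (mate \<mu>) = u \<mu> * inc \<mu> (mate \<mu>)"
    unfolding appl_def using finite_X \<mu>U U_sub by (subst sum.remove[of _ \<mu>]) auto
  then show False using zero[OF mate_mem[OF \<mu>U]] unit[OF \<mu>U] \<mu> by auto
qed

text \<open>
  A cycle \<open>z\<close> of the Morse complex becomes a cycle of the full complex after subtraction of a chain
  supported on \<open>U\<close>; that cycle bounds, and \<open>P\<close> maps the bounding chain to one for \<open>z\<close>.
\<close>

lemma morse_exact:
  assumes exact: "\<And>z. (\<And>\<tau>. \<tau> \<in> X \<Longrightarrow> bd z \<tau> = 0) \<Longrightarrow> \<exists>w. \<forall>\<tau>\<in>X. z \<tau> = bd w \<tau>"
    and z: "supp_in K z" and cycle: "\<And>\<tau>. \<tau> \<in> K \<Longrightarrow> pr (bd z) \<tau> = 0"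
  shows "\<exists>w. supp_in K w \<and> (\<forall>\<tau>\<in>K. z \<tau> = pr (bd w) \<tau>)"
proof -
  have "pr (bd z) \<tau> = 0" for \<tau>
    using cycle supp_pr[of "bd z"] by (auto simp: supp_in_def)
  then have "null (bd z)" using null_minus_pr[of "bd z"] by simp
  then obtain u u' where u: "supp_in U u" "supp_in U u'" "\<forall>x\<in>X. bd z x = u x + bd u' x"
    unfolding null_def by blast
  have "bd u x = 0" if "x \<in> X" for x
  proof -
    have "bd (bd z) x = bd (\<lambda>x. u x + bd u' x) x" using u(3) by (intro appl_cong) auto
    then show ?thesis using bd_bd[OF that] by (simp add: appl_add)
  qed
  then have "u x = 0" for x using bd_upper_inj[OF u(1)] by blast
  then have "bd (\<lambda>x. z x - u' x) \<tau> = 0" if "\<tau> \<in> X" for \<tau>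
    using u(3) that by (simp add: appl_diff)
  then obtain w where w: "\<forall>\<tau>\<in>X. z \<tau> - u' \<tau> = bd w \<tau>"
    using exact by blast
  have "z \<tau> = pr (bd (pr w)) \<tau>" if "\<tau> \<in> K" for \<tau>
  proof -
    have "pr (\<lambda>x. z x - u' x) \<tau> = pr (bd w) \<tau>" using w by (intro appl_cong) auto
    then show ?thesis
      using pr_upper[OF u(2)] pr_critical[OF z that] by (simp add: appl_diff pr_bd_pr)
  qed
  then show ?thesis using supp_pr by blast
qed

end


section \<open>Exactness of the simplex\<close>

context ordered_gens
begin

text \<open>The sign of \<open>\<tau>\<close> in the boundary of \<open>insert m \<tau>\<close>.\<close>

definition sign :: "'v mon set \<Rightarrow> 'v mon \<Rightarrow> 'k::field" where
  "sign \<tau> m = (- 1) ^ card {n \<in> \<tau>. rk n < rk m}"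

lemma incidence_insert:
  assumes "insert m \<tau> \<subseteq> G" "m \<notin> \<tau>"
  shows "incidence r (insert m \<tau>) \<tau> = sign \<tau> m"
proof -
  have f: "facet (insert m \<tau>) \<tau>" unfolding facet_def using assms by (intro bexI[of _ m]) auto
  have "insert m \<tau> - \<tau> = {m}" using assms by auto
  moreover have "{m' \<in> insert m \<tau>. dominates r m m'} = {n \<in> \<tau>. rk n < rk m}"
    using assms dominates_iff_rk[of m] by (auto simp: dominates_def)
  ultimately show ?thesis using f by (simp add: incidence_def sign_def)
qed

lemma sign_insert:
  assumes "finite \<tau>" "n \<notin> \<tau>"
  shows "sign (insert n \<tau>) m = (if rk n < rk m then - sign \<tau> m else sign \<tau> m :: 'k::field)"
proof -
  have "{k \<in> insert n \<tau>. rk k < rk m} =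
      (if rk n < rk m then insert n {k \<in> \<tau>. rk k < rk m} else {k \<in> \<tau>. rk k < rk m})"
    by auto
  then show ?thesis using assms by (simp add: sign_def)
qed

lemma sum_incidence_cofacets:
  assumes "H \<subseteq> G" "\<tau> \<subseteq> H"
  shows "(\<Sum>\<sigma>\<in>Pow H. f \<sigma> * incidence r \<sigma> \<tau>) = (\<Sum>m\<in>H - \<tau>. f (insert m \<tau>) * sign \<tau> m)"
proof -
  have fin: "finite (Pow H)" using assms finite_sub by simp
  have "(\<Sum>\<sigma>\<in>Pow H. f \<sigma> * incidence r \<sigma> \<tau>) =
      (\<Sum>\<sigma>\<in>(\<lambda>m. insert m \<tau>) ` (H - \<tau>). f \<sigma> * incidence r \<sigma> \<tau>)"
  proof (rule sum.mono_neutral_right[OF fin])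
    show "\<forall>\<sigma>\<in>Pow H - (\<lambda>m. insert m \<tau>) ` (H - \<tau>). f \<sigma> * incidence r \<sigma> \<tau> = 0"
    proof
      fix \<sigma>
      assume \<sigma>: "\<sigma> \<in> Pow H - (\<lambda>m. insert m \<tau>) ` (H - \<tau>)"
      have "\<not> facet \<sigma> \<tau>"
      proof
        assume "facet \<sigma> \<tau>"
        then obtain m where "m \<in> \<sigma>" "\<tau> = \<sigma> - {m}" by (auto simp: facet_def)
        then have "\<sigma> = insert m \<tau>" "m \<in> H - \<tau>" using \<sigma> by auto
        then show False using \<sigma> by blast
      qed
      then show "f \<sigma> * incidence r \<sigma> \<tau> = 0" by (simp add: incidence_def)
    qed
  qed (use assms in auto)
  also have "\<dots> = (\<Sum>m\<in>H - \<tau>. f (insert m \<tau>) * incidence r (insert m \<tau>) \<tau>)"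
    by (subst sum.reindex) (auto simp: inj_on_def)
  also have "\<dots> = (\<Sum>m\<in>H - \<tau>. f (insert m \<tau>) * sign \<tau> m)"
    using assms by (intro sum.cong refl) (auto simp: incidence_insert subset_iff)
  finally show ?thesis .
qed

lemma incidence_square_zero:
  assumes H: "H \<subseteq> G" and x: "x \<subseteq> H" and z: "z \<subseteq> H"
  shows "(\<Sum>y\<in>Pow H. incidence r x y * incidence r y z) = (0 :: 'k::field)"
proof -
  have finH: "finite H" using H finite_sub by blast
  have "(\<Sum>y\<in>Pow H. incidence r x y * incidence r y z) =
      (\<Sum>m\<in>H - z. incidence r x (insert m z) * sign z m :: 'k)"
    by (rule sum_incidence_cofacets[OF H z])
  also have "\<dots> = 0"
  proof (cases "\<exists>a b. a \<noteq> b \<and> a \<notin> z \<and> b \<notin> z \<and> x = insert a (insert b z)")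
    case False
    have "\<not> facet x (insert m z)" if m: "m \<in> H - z" for m
    proof
      assume "facet x (insert m z)"
      then obtain n where n: "n \<in> x" "insert m z = x - {n}" by (auto simp: facet_def)
      then have "x = insert n (insert m z)" "n \<noteq> m" "n \<notin> z" by auto
      then show False using False m by blast
    qed
    then show ?thesis by (intro sum.neutral) (simp add: incidence_def)
  next
    case True
    then obtain a b where ab: "a \<notin> z" "b \<notin> z" "x = insert a (insert b z)" "rk a < rk b"
    proof -
      obtain a b where ab: "a \<noteq> b" "a \<notin> z" "b \<notin> z" "x = insert a (insert b z)" using True by blast
      have "rk a \<noteq> rk b" using ab x H rk_inj[of a b] by auto
      then consider "rk a < rk b" | "rk b < rk a" by linarith
      then show ?thesis using that[of a b] that[of b a] ab by (cases) (auto simp: insert_commute)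
    qed
    have mem: "a \<in> H" "b \<in> H" "a \<noteq> b" using ab x by auto
    have "incidence r x (insert m z) = (0 :: 'k)" if "m \<in> H - z - {a, b}" for m
      using that ab(3) by (auto simp: incidence_def facet_def)
    then have "(\<Sum>m\<in>H - z. incidence r x (insert m z) * sign z m :: 'k) =
        (\<Sum>m\<in>{a, b}. incidence r x (insert m z) * sign z m)"
      using finH mem ab by (intro sum.mono_neutral_right) auto
    also have "\<dots> = incidence r x (insert a z) * sign z a + incidence r x (insert b z) * sign z b"
      using mem by simp
    also have "incidence r x (insert a z) = (sign (insert a z) b :: 'k)"
      using ab mem H z by (simp add: insert_commute[of a b] incidence_insert subset_iff)
    also have "incidence r x (insert b z) = (sign (insert b z) a :: 'k)"
      using ab mem H z by (simp add: incidence_insert subset_iff)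
    also have "sign (insert a z) b * sign z a + sign (insert b z) a * sign z b = (0 :: 'k)"
      using sign_insert[of z a b, where 'k = 'k] sign_insert[of z b a, where 'k = 'k] ab finite_subset[OF z finH] by simp
    finally show ?thesis .
  qed
  finally show ?thesis .
qed

text \<open>The full simplex is a cone over its smallest vertex.\<close>

lemma simplex_exact:
  fixes z :: "'v mon set \<Rightarrow> 'k::field"
  assumes H: "H \<subseteq> G" "H \<noteq> {}"
    and cycle: "\<And>\<tau>. \<tau> \<subseteq> H \<Longrightarrow> (\<Sum>\<sigma>\<in>Pow H. z \<sigma> * incidence r \<sigma> \<tau>) = 0"
  shows "\<exists>w. \<forall>\<tau>\<in>Pow H. z \<tau> = (\<Sum>\<sigma>\<in>Pow H. w \<sigma> * incidence r \<sigma> \<tau>)"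
proof -
  have finH: "finite H" using H finite_sub by blast
  obtain h where h: "h \<in> H" and le: "\<And>m. m \<in> H \<Longrightarrow> rk h \<le> rk m"
    using ex_has_least_nat[of "\<lambda>m. m \<in> H" _ rk] H(2) by blast
  have less: "rk h < rk m" if "m \<in> H" "m \<noteq> h" for m
    using le[OF that(1)] rk_inj[of h m] that h H(1) by (metis le_neq_implies_less subsetD)
  \<comment> \<open>The contraction that adjoins \<open>h\<close>; the sign is \<open>1\<close> because \<open>h\<close> is the smallest vertex.\<close>
  define w where "w \<sigma> = (if h \<in> \<sigma> then z (\<sigma> - {h}) else 0)" for \<sigma>
  have "z \<tau> = (\<Sum>\<sigma>\<in>Pow H. w \<sigma> * incidence r \<sigma> \<tau>)" if \<tau>: "\<tau> \<subseteq> H" for \<tau>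
  proof (cases "h \<in> \<tau>")
    case False
    have none: "{n \<in> \<tau>. rk n < rk h} = {}" using le \<tau> by (auto simp: not_less subset_iff)
    have "(\<Sum>m\<in>H - \<tau>. w (insert m \<tau>) * sign \<tau> m) = (\<Sum>m\<in>{h}. w (insert m \<tau>) * sign \<tau> m)"
      using finH h False by (intro sum.mono_neutral_right) (auto simp: w_def)
    also have "\<dots> = z \<tau>" using False by (simp add: w_def sign_def none)
    finally show ?thesis by (simp add: sum_incidence_cofacets[OF H(1) \<tau>])
  next
    case True
    define \<tau>' where "\<tau>' = \<tau> - {h}"
    have \<tau>': "\<tau>' \<subseteq> H" "h \<notin> \<tau>'" "\<tau> = insert h \<tau>'" using \<tau> True by (auto simp: \<tau>'_def)
    have none: "{n \<in> \<tau>'. rk n < rk h} = {}" using le \<tau>' by (auto simp: not_less subset_iff)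
    have "0 = (\<Sum>m\<in>H - \<tau>'. z (insert m \<tau>') * sign \<tau>' m)"
      using cycle[OF \<tau>'(1)] by (simp add: sum_incidence_cofacets[OF H(1) \<tau>'(1)])
    also have "\<dots> = z \<tau> * sign \<tau>' h + (\<Sum>m\<in>H - \<tau>' - {h}. z (insert m \<tau>') * sign \<tau>' m)"
      using sum.remove[of "H - \<tau>'" h] finH h \<tau>' by simp
    also have "H - \<tau>' - {h} = H - \<tau>" using \<tau>' by auto
    also have "sign \<tau>' h = (1 :: 'k)" by (simp add: sign_def none)
    finally have "z \<tau> = - (\<Sum>m\<in>H - \<tau>. z (insert m \<tau>') * sign \<tau>' m)"
      by (simp add: eq_neg_iff_add_eq_0)
    also have "\<dots> = (\<Sum>m\<in>H - \<tau>. w (insert m \<tau>) * sign \<tau> m)"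
      unfolding sum_negf[symmetric]
    proof (rule sum.cong[OF refl])
      fix m
      assume m: "m \<in> H - \<tau>"
      have "sign \<tau> m = (- sign \<tau>' m :: 'k)"
        using sign_insert[of \<tau>' h m, where 'k = 'k] less[of m] m True \<tau>' finite_subset[OF \<tau>'(1) finH] by auto
      moreover have "insert m \<tau> - {h} = insert m \<tau>'" using m True \<tau>' by auto
      ultimately show "- (z (insert m \<tau>') * sign \<tau>' m) = w (insert m \<tau>) * sign \<tau> m"
        using True by (simp add: w_def)
    qed
    finally show ?thesis by (simp add: sum_incidence_cofacets[OF H(1) \<tau>])
  qed
  then show ?thesis by blast
qed

end


section \<open>Strands of the Barile-Macchia complex\<close>

context ordered_gens
begin

text \<open>
  In multidegree \<open>t\<close> the Taylor complex is the chain complex of the full simplex on the generators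
  that divide \<open>t\<close>, and the matching restricts to it since matched sets have the same lcm.
\<close>

definition gens_dvd :: "'v mon \<Rightarrow> 'v mon set" where
  "gens_dvd t = {m \<in> G. mon_dvd m t}"

lemma gens_dvd_sub: "gens_dvd t \<subseteq> G"
  by (auto simp: gens_dvd_def)

lemma subset_gens_dvd_iff:
  "\<sigma> \<subseteq> gens_dvd t \<longleftrightarrow> \<sigma> \<subseteq> G \<and> mon_dvd (mon_lcm \<sigma>) t"
  unfolding gens_dvd_def using finite_sub[of \<sigma>] mon_lcm_dvd_iff[of \<sigma> t] by auto

text \<open>The critical sets whose lcm divides \<open>t\<close>.\<close>

definition crit_dvd :: "'v mon \<Rightarrow> 'v mon set set" where
  "crit_dvd t = {\<sigma>. \<sigma> \<subseteq> gens_dvd t \<and> critical G r \<sigma>}"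

text \<open>The projection matrix given by the path sums.\<close>

definition proj :: "'v mon \<Rightarrow> 'v mon set \<Rightarrow> 'v mon set \<Rightarrow> 'k::field" where
  "proj t \<rho> \<tau> = (if \<tau> \<in> crit_dvd t \<and> card \<rho> = card \<tau> then path_sum \<rho> \<tau> else 0)"

text \<open>The coefficient of \<open>\<tau>\<close> in the Barile-Macchia differential of \<open>\<sigma>\<close>.\<close>

definition coef :: "'v mon set \<Rightarrow> 'v mon set \<Rightarrow> 'k::field" where
  "coef \<sigma> \<tau> = (\<Sum>\<rho> | facet \<sigma> \<rho>. incidence r \<sigma> \<rho> * path_sum \<rho> \<tau>)"

lemma sum_incidence_proj:
  assumes \<sigma>: "\<sigma> \<subseteq> gens_dvd t" and \<tau>: "\<tau> \<in> crit_dvd t"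
  shows "(\<Sum>\<rho>\<in>Pow (gens_dvd t). incidence r \<sigma> \<rho> * proj t \<rho> \<tau>) =
    (if card \<sigma> = Suc (card \<tau>) then coef \<sigma> \<tau> else 0 :: 'k::field)"
proof -
  have \<sigma>G: "\<sigma> \<subseteq> G" using \<sigma> gens_dvd_sub by blast
  have fin: "finite (Pow (gens_dvd t))" using finite_sub[OF gens_dvd_sub] by simp
  have "(\<Sum>\<rho>\<in>Pow (gens_dvd t). incidence r \<sigma> \<rho> * proj t \<rho> \<tau>) =
      (\<Sum>\<rho> | facet \<sigma> \<rho>. incidence r \<sigma> \<rho> * proj t \<rho> \<tau> :: 'k)"
    using fin \<sigma> by (intro sum.mono_neutral_right) (auto simp: incidence_def facet_def)
  also have "\<dots> = (if card \<sigma> = Suc (card \<tau>) then coef \<sigma> \<tau> else 0)"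
  proof (cases "card \<sigma> = Suc (card \<tau>)")
    case True
    then show ?thesis
      unfolding coef_def using \<tau> card_facet[OF \<sigma>G] by (auto intro!: sum.cong simp: proj_def)
  next
    case False
    then show ?thesis
      using card_facet[OF \<sigma>G] by (auto intro!: sum.neutral simp: proj_def)
  qed
  finally show ?thesis .
qed

lemma morse_reduction_strand:
  "morse_reduction (Pow (gens_dvd t)) {\<sigma> \<in> Pow (gens_dvd t). type2 G r \<sigma>} (crit_dvd t)
     mate (descent\<^sup>+) (incidence r) (proj t :: _ \<Rightarrow> _ \<Rightarrow> 'k::field)"
proof
  show "finite (Pow (gens_dvd t))" using finite_sub[OF gens_dvd_sub] by simp
  show "crit_dvd t \<subseteq> Pow (gens_dvd t)" by (auto simp: crit_dvd_def)
  show "wf (descent\<^sup>+)" by (rule wf_trancl[OF wf_descent])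
next
  fix x
  assume x: "x \<in> Pow (gens_dvd t)"
  have xG: "x \<subseteq> G" "mon_dvd (mon_lcm x) t" using x subset_gens_dvd_iff by auto
  have "\<tau> \<subseteq> gens_dvd t" if "type2 G r \<tau>" "x = mate \<tau>" for \<tau>
    using that mon_lcm_mate[OF type2_pot[OF that(1)]] type2_sub[OF that(1)] xG
    by (subst subset_gens_dvd_iff) auto
  then show "x \<in> crit_dvd t \<or> x \<in> {\<sigma> \<in> Pow (gens_dvd t). type2 G r \<sigma>} \<or>
      x \<in> mate ` {\<sigma> \<in> Pow (gens_dvd t). type2 G r \<sigma>}"
    using x xG unfolding crit_dvd_def critical_iff by blast
next
  fix \<sigma>
  assume \<sigma>: "\<sigma> \<in> {\<sigma> \<in> Pow (gens_dvd t). type2 G r \<sigma>}"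
  then show "mate \<sigma> \<in> Pow (gens_dvd t)" by auto
  show "incidence r \<sigma> (mate \<sigma>) \<noteq> (0 :: 'k)"
    using incidence_square[OF facet_mate, of \<sigma>, where 'k = 'k] \<sigma> by auto
  fix \<sigma>'
  assume \<sigma>': "\<sigma>' \<in> {\<sigma> \<in> Pow (gens_dvd t). type2 G r \<sigma>}" and "\<sigma> \<noteq> \<sigma>'"
    and "incidence r \<sigma> (mate \<sigma>') \<noteq> (0 :: 'k)"
  then have "facet \<sigma> (mate \<sigma>')" "mate \<sigma> \<noteq> mate \<sigma>'"
    using \<sigma> mate_inj[of \<sigma> \<sigma>'] by (auto simp: incidence_def split: if_splits)
  then have "edge \<sigma> (mate \<sigma>')" "edge (mate \<sigma>') \<sigma>'"
    using \<sigma>' by (auto simp: morse_edge_def mem_bm_matching_iff)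
  then have "(mate \<sigma>', \<sigma>) \<in> descent" "(\<sigma>', mate \<sigma>') \<in> descent"
    using edge_props[of \<sigma> "mate \<sigma>'"] edge_props[of "mate \<sigma>'" \<sigma>'] \<sigma> \<sigma>' type2_sub by auto
  then show "(\<sigma>', \<sigma>) \<in> descent\<^sup>+" by (meson r_into_trancl trancl_trans)
next
  fix x z
  assume "x \<in> Pow (gens_dvd t)" "z \<in> Pow (gens_dvd t)"
  then show "(\<Sum>y\<in>Pow (gens_dvd t). incidence r x y * incidence r y z) = (0 :: 'k)"
    by (intro incidence_square_zero gens_dvd_sub) auto
next
  fix \<kappa> \<tau>
  assume "\<kappa> \<in> crit_dvd t" "\<tau> \<in> crit_dvd t"
  then show "proj t \<kappa> \<tau> = (if \<kappa> = \<tau> then 1 else 0 :: 'k)"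
    by (cases "card \<kappa> = card \<tau>") (simp_all add: proj_def crit_dvd_def path_sum_critical split del: if_split, auto)
next
  fix \<sigma> \<tau>
  assume \<sigma>: "\<sigma> \<in> {\<sigma> \<in> Pow (gens_dvd t). type2 G r \<sigma>}" and \<tau>: "\<tau> \<in> crit_dvd t"
  then show "proj t \<sigma> \<tau> = (0 :: 'k)"
    unfolding proj_def using path_sum_type2[of \<sigma> \<tau>] by (auto simp: crit_dvd_def)
  have "card \<sigma> = Suc (card \<tau>) \<Longrightarrow> coef \<sigma> \<tau> = (0 :: 'k)"
    unfolding coef_def using path_sum_boundary_type2[of \<sigma> \<tau>] \<sigma> \<tau> by (auto simp: crit_dvd_def)
  then show "(\<Sum>\<rho>\<in>Pow (gens_dvd t). incidence r \<sigma> \<rho> * proj t \<rho> \<tau>) = (0 :: 'k)"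
    using sum_incidence_proj[of \<sigma> t \<tau>, where 'k = 'k] \<sigma> \<tau> by auto
qed (auto simp: proj_def)

text \<open>The part in homological degree \<open>n\<close> of the basis of the strand of multidegree \<open>t\<close>.\<close>

definition strand_basis :: "'v mon \<Rightarrow> nat \<Rightarrow> 'v mon set set" where
  "strand_basis t n = {\<sigma> \<in> crit_dvd t. card \<sigma> = n}"

context
  fixes t :: "'v mon"
begin

interpretation M: morse_reduction "Pow (gens_dvd t)" "{\<sigma> \<in> Pow (gens_dvd t). type2 G r \<sigma>}"
  "crit_dvd t" mate "descent\<^sup>+" "incidence r" "proj t :: _ \<Rightarrow> _ \<Rightarrow> 'k::field"
  by (rule morse_reduction_strand)

lemma pr_bd_eq:
  assumes f: "M.supp_in (crit_dvd t) f" and \<tau>: "\<tau> \<in> crit_dvd t"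
  shows "M.pr (M.bd f) \<tau> = (\<Sum>\<sigma>\<in>strand_basis t (Suc (card \<tau>)). f \<sigma> * coef \<sigma> \<tau>)"
proof -
  have "M.pr (M.bd f) \<tau> =
      (\<Sum>\<sigma>\<in>Pow (gens_dvd t). f \<sigma> * (if card \<sigma> = Suc (card \<tau>) then coef \<sigma> \<tau> else 0))"
    unfolding M.appl_appl
    by (intro sum.cong refl) (simp add: sum_incidence_proj \<tau>)
  also have "\<dots> = (\<Sum>\<sigma>\<in>strand_basis t (Suc (card \<tau>)).
      f \<sigma> * (if card \<sigma> = Suc (card \<tau>) then coef \<sigma> \<tau> else 0))"
    using f M.K_sub M.finite_X
    by (intro sum.mono_neutral_right) (auto simp: strand_basis_def M.supp_in_def)
  also have "\<dots> = (\<Sum>\<sigma>\<in>strand_basis t (Suc (card \<tau>)). f \<sigma> * coef \<sigma> \<tau>)"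
    by (intro sum.cong) (auto simp: strand_basis_def)
  finally show ?thesis .
qed

lemma strand_square:
  fixes f :: "'v mon set \<Rightarrow> 'k::field"
  assumes \<tau>: "\<tau> \<in> strand_basis t n"
  shows "(\<Sum>\<rho>\<in>strand_basis t (Suc n).
    (\<Sum>\<sigma>\<in>strand_basis t (Suc (Suc n)). f \<sigma> * coef \<sigma> \<rho>) * coef \<rho> \<tau>) = 0"
proof -
  define g where "g \<sigma> = (if \<sigma> \<in> crit_dvd t then f \<sigma> else 0)" for \<sigma>
  have g: "M.supp_in (crit_dvd t) g" by (simp add: g_def M.supp_in_def)
  have "0 = M.pr (M.bd (M.pr (M.bd g))) \<tau>" by (simp add: M.morse_boundary_square)
  also have "\<dots> = (\<Sum>\<rho>\<in>strand_basis t (Suc n). M.pr (M.bd g) \<rho> * coef \<rho> \<tau>)"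
    using \<tau> pr_bd_eq[OF M.supp_pr] by (auto simp: strand_basis_def)
  also have "\<dots> = (\<Sum>\<rho>\<in>strand_basis t (Suc n).
    (\<Sum>\<sigma>\<in>strand_basis t (Suc (Suc n)). f \<sigma> * coef \<sigma> \<rho>) * coef \<rho> \<tau>)"
  proof (intro sum.cong refl)
    fix \<rho>
    assume "\<rho> \<in> strand_basis t (Suc n)"
    then have "M.pr (M.bd g) \<rho> = (\<Sum>\<sigma>\<in>strand_basis t (Suc (Suc n)). g \<sigma> * coef \<sigma> \<rho>)"
      using pr_bd_eq[OF g] by (auto simp: strand_basis_def)
    also have "\<dots> = (\<Sum>\<sigma>\<in>strand_basis t (Suc (Suc n)). f \<sigma> * coef \<sigma> \<rho>)"
      by (intro sum.cong) (auto simp: strand_basis_def g_def)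
    finally show "M.pr (M.bd g) \<rho> * coef \<rho> \<tau> =
        (\<Sum>\<sigma>\<in>strand_basis t (Suc (Suc n)). f \<sigma> * coef \<sigma> \<rho>) * coef \<rho> \<tau>" by simp
  qed
  finally show ?thesis by simp
qed

lemma strand_exact:
  fixes z :: "'v mon set \<Rightarrow> 'k::field"
  assumes ne: "gens_dvd t \<noteq> {}"
    and cycle: "\<And>n' \<tau>. n = Suc n' \<Longrightarrow> \<tau> \<in> strand_basis t n' \<Longrightarrow>
      (\<Sum>\<sigma>\<in>strand_basis t n. z \<sigma> * coef \<sigma> \<tau>) = 0"
  shows "\<exists>w. (\<forall>\<sigma>. \<sigma> \<notin> strand_basis t (Suc n) \<longrightarrow> w \<sigma> = 0) \<and>
    (\<forall>\<tau>\<in>strand_basis t n. z \<tau> = (\<Sum>\<sigma>\<in>strand_basis t (Suc n). w \<sigma> * coef \<sigma> \<tau>))"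
proof -
  define y where "y \<sigma> = (if \<sigma> \<in> strand_basis t n then z \<sigma> else 0)" for \<sigma>
  have y: "M.supp_in (crit_dvd t) y" by (simp add: y_def M.supp_in_def strand_basis_def)
  have "\<exists>w. M.supp_in (crit_dvd t) w \<and> (\<forall>\<tau>\<in>crit_dvd t. y \<tau> = M.pr (M.bd w) \<tau>)"
  proof (rule M.morse_exact[OF _ y])
    show "\<exists>w. \<forall>\<tau>\<in>Pow (gens_dvd t). z \<tau> = M.bd w \<tau>"
      if "\<And>\<tau>. \<tau> \<in> Pow (gens_dvd t) \<Longrightarrow> M.bd z \<tau> = 0" for z
      using simplex_exact[OF gens_dvd_sub ne, of z] that unfolding M.appl_def by blast
  next
    fix \<tau>
    assume \<tau>: "\<tau> \<in> crit_dvd t"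
    show "M.pr (M.bd y) \<tau> = 0"
    proof (cases "n = Suc (card \<tau>)")
      case True
      then have "(\<Sum>\<sigma>\<in>strand_basis t n. z \<sigma> * coef \<sigma> \<tau>) = 0"
        using \<tau> by (intro cycle) (auto simp: strand_basis_def)
      then show ?thesis using True by (simp add: pr_bd_eq[OF y \<tau>] y_def)
    next
      case False
      then show ?thesis
        unfolding pr_bd_eq[OF y \<tau>] by (intro sum.neutral) (auto simp: strand_basis_def y_def)
    qed
  qed
  then obtain w where w: "M.supp_in (crit_dvd t) w" "\<forall>\<tau>\<in>crit_dvd t. y \<tau> = M.pr (M.bd w) \<tau>"
    by blast
  let ?w = "\<lambda>\<sigma>. if \<sigma> \<in> strand_basis t (Suc n) then w \<sigma> else 0"
  have "z \<tau> = (\<Sum>\<sigma>\<in>strand_basis t (Suc n). ?w \<sigma> * coef \<sigma> \<tau>)" if "\<tau> \<in> strand_basis t n" for \<tau>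
  proof -
    have \<tau>: "\<tau> \<in> crit_dvd t" "card \<tau> = n" using that by (auto simp: strand_basis_def)
    have "z \<tau> = y \<tau>" using that by (simp add: y_def)
    also have "\<dots> = (\<Sum>\<sigma>\<in>strand_basis t (Suc n). w \<sigma> * coef \<sigma> \<tau>)"
      using w(2) pr_bd_eq[OF w(1) \<tau>(1)] \<tau> by auto
    finally show ?thesis by simp
  qed
  then show ?thesis by (intro exI[of _ ?w]) auto
qed

end

lemma coef_nonzeroD:
  assumes "\<sigma> \<subseteq> G" "coef \<sigma> \<tau> \<noteq> (0 :: 'k::field)"
  obtains \<rho> where "facet \<sigma> \<rho>" "mon_dvd (mon_lcm \<tau>) (mon_lcm \<rho>)" "mon_dvd (mon_lcm \<rho>) (mon_lcm \<sigma>)"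
proof -
  obtain \<rho> where \<rho>: "facet \<sigma> \<rho>" "path_sum \<rho> \<tau> \<noteq> (0 :: 'k)"
    using assms(2) unfolding coef_def by (metis (mono_tags, lifting) mem_Collect_eq mult_zero_right sum.neutral)
  have "\<rho> \<subseteq> \<sigma>" using facet_sub[OF \<rho>(1)] .
  then show ?thesis
    using that[OF \<rho>(1)] path_sum_nonzeroD(2)[OF _ \<rho>(2)] assms(1) mon_lcm_mono[of \<sigma> \<rho>] finite_sub
    by blast
qed

end


section \<open>The Barile-Macchia resolution of a monomial ideal\<close>

text \<open>A finitely generated monomial ideal with a total order on its minimal generators.\<close>

locale monomial_ideal_order =
  fixes S :: "'v::finite mon set" and I :: "('v, 'k::field) mpol set" and r :: "'v mon rel"
  assumes finite_S: "finite S" and I_eq: "I = ideal_gen (monom ` S)"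
    and linear_order: "linear_order_on (min_gens I) r"
begin

sublocale ordered_gens "min_gens I" r
  using finite_S linear_order by unfold_locales (auto simp: I_eq min_gens_monomial_ideal)

abbreviation C :: "('v mon set, ('v, 'k) mpol) based_complex" where
  "C \<equiv> bm_resolution I r"

lemma basis_C: "basis C n = {\<sigma>. critical (min_gens I) r \<sigma> \<and> card \<sigma> = n}"
  by (simp add: bm_resolution_def Let_def)

lemma bdeg_C: "bdeg C \<sigma> = mon_deg (mon_lcm \<sigma>)"
  by (simp add: bm_resolution_def Let_def)

lemma entry_C: "entry C \<sigma> \<tau> = Poly_Mapping.single (mon_lcm \<sigma> - mon_lcm \<tau>) (coef \<sigma> \<tau>)"
  by (simp add: bm_resolution_def Let_def coef_def path_sum_def)

lemma aug_C: "aug C \<sigma> = 1"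
  by (simp add: bm_resolution_def Let_def)

lemma basis_sub: "\<sigma> \<in> basis C n \<Longrightarrow> \<sigma> \<subseteq> min_gens I"
  by (simp add: basis_C critical_iff)

lemma finite_basis: "finite (basis C n)"
  by (rule finite_subset[of _ "Pow (min_gens I)"]) (use basis_sub finite_G in auto)

lemma strand_basis_eq: "strand_basis t n = {\<sigma> \<in> basis C n. mon_dvd (mon_lcm \<sigma>) t}"
  by (auto simp: strand_basis_def crit_dvd_def basis_C subset_gens_dvd_iff critical_iff)

lemma coef_dvd:
  assumes "b \<in> basis C n" "coef b c \<noteq> (0 :: 'k)"
  shows "mon_dvd (mon_lcm c) (mon_lcm b)"
  using assms coef_nonzeroD[of b c] basis_sub mon_dvd_trans by metis

lemma mem_I_iff:
  "p \<in> I \<longleftrightarrow> (\<forall>t. Poly_Mapping.lookup p t \<noteq> 0 \<longrightarrow> gens_dvd t \<noteq> {})"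
proof -
  have "gens_dvd t \<noteq> {} \<longleftrightarrow> (\<exists>s\<in>S. mon_dvd s t)" for t
    using min_gens_dvd_iff[of S t, where 'k = 'k] unfolding gens_dvd_def I_eq[symmetric] by blast
  then show ?thesis unfolding I_eq monomial_ideal_iff by simp
qed

text \<open>
  The coefficient vector of the component of multidegree \<open>t\<close> of an element of a free module whose
  basis element \<open>\<sigma>\<close> has multidegree \<open>mon_lcm \<sigma>\<close>.
\<close>

definition strand :: "('v mon set \<Rightarrow> ('v, 'k) mpol) \<Rightarrow> 'v mon \<Rightarrow> 'v mon set \<Rightarrow> 'k" where
  "strand f t \<sigma> =
    (if mon_dvd (mon_lcm \<sigma>) t then Poly_Mapping.lookup (f \<sigma>) (t - mon_lcm \<sigma>) else 0)"

lemma lookup_eq_strand: "Poly_Mapping.lookup (f \<sigma>) s = strand f (s + mon_lcm \<sigma>) \<sigma>"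
  by (simp add: strand_def)

lemma free_module_eqI:
  assumes "f \<in> free_module C n" "g \<in> free_module C n"
    and "\<And>t \<sigma>. \<sigma> \<in> strand_basis t n \<Longrightarrow> strand f t \<sigma> = strand g t \<sigma>"
  shows "f = g"
proof
  fix \<sigma>
  show "f \<sigma> = g \<sigma>"
  proof (cases "\<sigma> \<in> basis C n")
    case True
    then have "Poly_Mapping.lookup (f \<sigma>) s = Poly_Mapping.lookup (g \<sigma>) s" for s
      unfolding lookup_eq_strand by (intro assms(3)) (simp add: strand_basis_eq)
    then show ?thesis by (rule poly_mapping_eqI)
  qed (use assms in \<open>simp add: free_module_def\<close>)
qed

lemma differential_mem: "differential C n f \<in> free_module C n"
  by (simp add: differential_def free_module_def)

lemma strand_differential:
  assumes c: "c \<in> strand_basis t n"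
  shows "strand (differential C n f) t c = (\<Sum>b\<in>strand_basis t (Suc n). strand f t b * coef b c)"
proof -
  have c': "c \<in> basis C n" "mon_dvd (mon_lcm c) t" using c by (auto simp: strand_basis_eq)
  have "strand (differential C n f) t c = (\<Sum>b\<in>basis C (Suc n).
      Poly_Mapping.lookup (f b * entry C b c) (t - mon_lcm c))"
    using c' by (simp add: strand_def differential_def lookup_sum)
  also have "\<dots> = (\<Sum>b\<in>basis C (Suc n). strand f t b * coef b c)"
  proof (rule sum.cong[OF refl])
    fix b
    assume b: "b \<in> basis C (Suc n)"
    show "Poly_Mapping.lookup (f b * entry C b c) (t - mon_lcm c) = strand f t b * coef b c"
    proof (cases "coef b c = (0 :: 'k)")
      case False
      then have cb: "mon_dvd (mon_lcm c) (mon_lcm b)" using coef_dvd b by blast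
      have "mon_dvd (mon_lcm b - mon_lcm c) (t - mon_lcm c) \<longleftrightarrow> mon_dvd (mon_lcm b) t"
        using cb c'(2) unfolding mon_dvd_def lookup_minus by (metis diff_le_mono le_diff_iff)
      moreover have "t - mon_lcm c - (mon_lcm b - mon_lcm c) = t - mon_lcm b"
        using cb by (intro poly_mapping_eqI) (simp add: lookup_minus mon_dvd_def)
      ultimately show ?thesis by (simp add: entry_C lookup_times_single strand_def)
    qed (simp add: entry_C)
  qed
  also have "\<dots> = (\<Sum>b\<in>strand_basis t (Suc n). strand f t b * coef b c)"
    using finite_basis by (intro sum.mono_neutral_right) (auto simp: strand_basis_eq strand_def)
  finally show ?thesis .
qed

lemma differential_square: "differential C n (differential C (Suc n) f) = (\<lambda>_. 0)"
proof (rule free_module_eqI[OF differential_mem, of _ n])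
  show "(\<lambda>_. 0) \<in> free_module C n" by (simp add: free_module_def)
next
  fix t \<sigma>
  assume \<sigma>: "\<sigma> \<in> strand_basis t n"
  have "strand (differential C n (differential C (Suc n) f)) t \<sigma> =
      (\<Sum>b\<in>strand_basis t (Suc n).
        (\<Sum>a\<in>strand_basis t (Suc (Suc n)). strand f t a * coef a b) * coef b \<sigma>)"
    by (simp add: strand_differential \<sigma>)
  then show "strand (differential C n (differential C (Suc n) f)) t \<sigma> = strand (\<lambda>_. 0) t \<sigma>"
    using strand_square[OF \<sigma>] by (simp add: strand_def)
qed

text \<open>An element is a boundary if its component in each multidegree is.\<close>

lemma boundary_if_strands:
  assumes f: "f \<in> free_module C n"
    and ex: "\<And>t. \<exists>w. (\<forall>\<sigma>. \<sigma> \<notin> strand_basis t (Suc n) \<longrightarrow> w \<sigma> = 0) \<and>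
      (\<forall>\<tau>\<in>strand_basis t n. strand f t \<tau> = (\<Sum>\<sigma>\<in>strand_basis t (Suc n). w \<sigma> * coef \<sigma> \<tau>))"
  shows "f \<in> differential C n ` free_module C (Suc n)"
proof -
  define T where "T = (\<Union>\<sigma>\<in>basis C n. (\<lambda>s. s + mon_lcm \<sigma>) ` Poly_Mapping.keys (f \<sigma>))"
  have finT: "finite T" unfolding T_def by (simp add: finite_basis)
  have T: "t \<in> T" if "\<tau> \<in> strand_basis t n" "strand f t \<tau> \<noteq> 0" for t \<tau>
  proof -
    have \<tau>: "\<tau> \<in> basis C n" "mon_dvd (mon_lcm \<tau>) t" using that by (auto simp: strand_basis_eq)
    then have "t - mon_lcm \<tau> \<in> Poly_Mapping.keys (f \<tau>)"
      using that(2) by (simp add: strand_def in_keys_iff)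
    then show ?thesis
      unfolding T_def
      by (intro UN_I[OF \<tau>(1)] image_eqI[of _ _ "t - mon_lcm \<tau>"]) (simp_all add: mon_dvd_diff_add \<tau>(2))
  qed
  \<comment> \<open>Outside the finite set \<open>T\<close> the solutions are replaced by \<open>0\<close>, so that they assemble to
    polynomials.\<close>
  obtain w0 where w0: "\<And>t \<sigma>. \<sigma> \<notin> strand_basis t (Suc n) \<Longrightarrow> w0 t \<sigma> = 0"
    "\<And>t \<tau>. \<tau> \<in> strand_basis t n \<Longrightarrow>
      strand f t \<tau> = (\<Sum>\<sigma>\<in>strand_basis t (Suc n). w0 t \<sigma> * coef \<sigma> \<tau>)"
    using ex by metis
  define w where "w t \<sigma> = (if t \<in> T then w0 t \<sigma> else 0)" for t \<sigma>
  have w: "strand f t \<tau> = (\<Sum>\<sigma>\<in>strand_basis t (Suc n). w t \<sigma> * coef \<sigma> \<tau>)"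
    if "\<tau> \<in> strand_basis t n" for t \<tau>
    using w0(2)[OF that] T[OF that] by (cases "t \<in> T") (auto simp: w_def)
  define g where "g \<sigma> = Poly_Mapping.Abs_poly_mapping (\<lambda>s. w (s + mon_lcm \<sigma>) \<sigma>)" for \<sigma>
  have lookup_g: "Poly_Mapping.lookup (g \<sigma>) s = w (s + mon_lcm \<sigma>) \<sigma>" for \<sigma> s
  proof -
    have "finite {s. w (s + mon_lcm \<sigma>) \<sigma> \<noteq> 0}"
    proof (rule finite_subset)
      show "{s. w (s + mon_lcm \<sigma>) \<sigma> \<noteq> 0} \<subseteq> (\<lambda>s. s + mon_lcm \<sigma>) -` T"
        by (auto simp: w_def split: if_splits)
      show "finite ((\<lambda>s. s + mon_lcm \<sigma>) -` T)"
        using finT by (intro finite_vimageI) (auto simp: inj_on_def)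
    qed
    then show ?thesis unfolding g_def by (simp add: Abs_poly_mapping_inverse)
  qed
  have strand_g: "strand g t \<sigma> = w t \<sigma>" for t \<sigma>
  proof (cases "mon_dvd (mon_lcm \<sigma>) t")
    case True
    then show ?thesis by (simp add: strand_def lookup_g mon_dvd_diff_add)
  next
    case False
    then show ?thesis using w0(1)[of \<sigma> t] by (simp add: strand_def w_def strand_basis_eq)
  qed
  have g: "g \<in> free_module C (Suc n)"
    unfolding free_module_def
  proof (intro CollectI allI impI)
    fix \<sigma>
    assume "\<sigma> \<notin> basis C (Suc n)"
    then show "g \<sigma> = 0"
      by (intro poly_mapping_eqI) (simp add: lookup_g w_def w0(1) strand_basis_eq)
  qed
  have "f = differential C n g"
    using w by (intro free_module_eqI[OF f differential_mem]) (simp add: strand_differential strand_g)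
  then show ?thesis using g by blast
qed

lemma exact_positive:
  "{f \<in> free_module C (Suc n). differential C n f = (\<lambda>_. 0)} =
    differential C (Suc n) ` free_module C (Suc (Suc n))"
proof (intro equalityI subsetI)
  fix f
  assume "f \<in> differential C (Suc n) ` free_module C (Suc (Suc n))"
  then show "f \<in> {f \<in> free_module C (Suc n). differential C n f = (\<lambda>_. 0)}"
    using differential_mem differential_square by auto
next
  fix f
  assume "f \<in> {f \<in> free_module C (Suc n). differential C n f = (\<lambda>_. 0)}"
  then have f: "f \<in> free_module C (Suc n)" and cycle: "differential C n f = (\<lambda>_. 0)" by auto
  show "f \<in> differential C (Suc n) ` free_module C (Suc (Suc n))"
  proof (rule boundary_if_strands[OF f])
    fix t
    show "\<exists>w. (\<forall>\<sigma>. \<sigma> \<notin> strand_basis t (Suc (Suc n)) \<longrightarrow> w \<sigma> = 0) \<and>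
      (\<forall>\<tau>\<in>strand_basis t (Suc n).
        strand f t \<tau> = (\<Sum>\<sigma>\<in>strand_basis t (Suc (Suc n)). w \<sigma> * coef \<sigma> \<tau>))"
    proof (cases "gens_dvd t = {}")
      case True
      then have "strand_basis t (Suc n) = {}" by (auto simp: strand_basis_def crit_dvd_def)
      then show ?thesis by (intro exI[of _ "\<lambda>_. 0"]) simp
    next
      case False
      show ?thesis
      proof (rule strand_exact[OF False])
        fix n' \<tau>
        assume "Suc n = Suc n'" and \<tau>: "\<tau> \<in> strand_basis t n'"
        then have "(\<Sum>\<sigma>\<in>strand_basis t (Suc n). strand f t \<sigma> * coef \<sigma> \<tau>) =
            strand (differential C n f) t \<tau>"
          by (simp add: strand_differential)
        then show "(\<Sum>\<sigma>\<in>strand_basis t (Suc n). strand f t \<sigma> * coef \<sigma> \<tau>) = 0"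
          by (simp add: cycle strand_def)
      qed
    qed
  qed
qed

lemma basis_0: "basis C 0 \<subseteq> {{}}"
  using finite_sub by (auto simp: basis_C critical_iff)

lemma augmentation_eq:
  assumes "f \<in> free_module C 0"
  shows "augmentation C f = f {}"
proof -
  consider "basis C 0 = {}" | "basis C 0 = {{}}" using basis_0 by (metis subset_singletonD)
  then show ?thesis
    by cases (use assms in \<open>simp_all add: augmentation_def aug_C free_module_def\<close>)
qed

lemma exact_zero:
  "{f \<in> free_module C 0. augmentation C f \<in> I} = differential C 0 ` free_module C 1"
proof (intro equalityI subsetI)
  fix f
  assume "f \<in> differential C 0 ` free_module C 1"
  then obtain g where fg: "f = differential C 0 g" by blast
  then have f: "f \<in> free_module C 0" by (simp add: differential_mem)
  have "gens_dvd t \<noteq> {}" if nz: "Poly_Mapping.lookup (f {}) t \<noteq> 0" for t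
  proof
    assume empty: "gens_dvd t = {}"
    have "{} \<in> basis C 0" using nz f by (auto simp: free_module_def)
    then have "{} \<in> strand_basis t 0" by (auto simp: strand_basis_eq mon_dvd_def)
    then have "Poly_Mapping.lookup (f {}) t = (\<Sum>b\<in>strand_basis t 1. strand g t b * coef b {})"
      using strand_differential[of "{}" t 0 g] fg by (simp add: lookup_eq_strand)
    also have "strand_basis t 1 = {}"
      using empty by (auto simp: strand_basis_def crit_dvd_def)
    finally show False using nz by simp
  qed
  then have "f {} \<in> I" using mem_I_iff by blast
  then show "f \<in> {f \<in> free_module C 0. augmentation C f \<in> I}"
    using f by (simp add: augmentation_eq)
next
  fix f
  assume "f \<in> {f \<in> free_module C 0. augmentation C f \<in> I}"
  then have f: "f \<in> free_module C 0" "f {} \<in> I" by (auto simp: augmentation_eq)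
  have "f \<in> differential C 0 ` free_module C (Suc 0)"
  proof (rule boundary_if_strands[OF f(1)])
    fix t
    show "\<exists>w. (\<forall>\<sigma>. \<sigma> \<notin> strand_basis t (Suc 0) \<longrightarrow> w \<sigma> = 0) \<and>
      (\<forall>\<tau>\<in>strand_basis t 0. strand f t \<tau> = (\<Sum>\<sigma>\<in>strand_basis t (Suc 0). w \<sigma> * coef \<sigma> \<tau>))"
    proof (cases "gens_dvd t = {}")
      case True
      then have "strand_basis t (Suc 0) = {}" by (auto simp: strand_basis_def crit_dvd_def)
      moreover have "Poly_Mapping.lookup (f {}) t = 0" using True f(2) mem_I_iff by blast
      then have "strand f t \<tau> = 0" if "\<tau> \<in> strand_basis t 0" for \<tau>
        using that basis_0 by (auto simp: strand_basis_eq strand_def)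
      ultimately show ?thesis by (intro exI[of _ "\<lambda>_. 0"]) simp
    next
      case False
      then show ?thesis by (rule strand_exact) simp
    qed
  qed
  then show "f \<in> differential C 0 ` free_module C 1" by simp
qed

lemma augmentation_surj: "\<exists>f\<in>free_module C 0. p - augmentation C f \<in> I"
proof (cases "{} \<in> basis C 0")
  case True
  let ?f = "\<lambda>b. if b = {} then p else 0"
  have f: "?f \<in> free_module C 0" using True by (auto simp: free_module_def)
  have "p - augmentation C ?f = 0" by (simp add: augmentation_eq[OF f])
  then show ?thesis using f by (intro bexI[of _ ?f]) (simp_all add: mem_I_iff)
next
  case False
  \<comment> \<open>Then the empty set is matched, which happens only if \<open>1\<close> is a generator.\<close>
  have "\<not> type2 (min_gens I) r {}"
    using bridge_mem pot_type2_sb type2_pot by blast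
  then obtain \<tau> where \<tau>: "type2 (min_gens I) r \<tau>" "{} = mate \<tau>"
    using False by (auto simp: basis_C critical_iff)
  have sb: "bridge \<tau> (sb r \<tau>)" using pot_type2_sb type2_pot \<tau>(1) by blast
  have "mon_dvd (sb r \<tau>) (mon_lcm (mate \<tau>))"
    using sb bridge_iff[OF type2_sub[OF \<tau>(1)]] by blast
  then have "sb r \<tau> = 0" using \<tau>(2) by (simp add: mon_dvd_zero_iff flip: \<tau>(2))
  moreover have "sb r \<tau> \<in> min_gens I" using bridge_mem[OF sb] type2_sub[OF \<tau>(1)] by blast
  ultimately have "gens_dvd t \<noteq> {}" for t
    by (auto simp: gens_dvd_def mon_dvd_def)
  then have all: "p \<in> I" for p using mem_I_iff by blast
  show ?thesis by (intro bexI[of _ "\<lambda>_. 0"]) (simp_all add: all free_module_def)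
qed

theorem graded_free_resolution_bm: "graded_free_resolution C I"
  unfolding graded_free_resolution_def
proof (intro conjI allI ballI)
  fix n b c t
  assume b: "b \<in> basis C (Suc n)" and "c \<in> basis C n" and "t \<in> Poly_Mapping.keys (entry C b c)"
  then have t: "t = mon_lcm b - mon_lcm c" and nz: "coef b c \<noteq> (0 :: 'k)"
    by (auto simp: entry_C split: if_splits)
  then show "mon_deg t + bdeg C c = bdeg C b"
    using mon_dvd_diff_add[OF coef_dvd[OF b nz]] by (simp add: bdeg_C flip: mon_deg_add)
next
  fix b t
  assume "b \<in> basis C 0" "t \<in> Poly_Mapping.keys (aug C b)"
  then have "b = {}" "t = 0" using basis_0 by (auto simp: aug_C)
  then show "mon_deg t = bdeg C b" by (simp add: bdeg_C)
qed (rule finite_basis augmentation_surj exact_zero exact_positive)+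

text \<open>
  A unit entry from \<open>b\<close> to \<open>c\<close> would require a gradient path from a facet of \<open>b\<close> to \<open>c\<close> along
  which the lcm stays equal to that of \<open>b\<close>, so that the omitted generator would be a bridge.
\<close>

theorem minimal_bm:
  assumes friendly: "bridge_friendly_wrt I r"
  shows "minimal_graded_free_resolution C I"
  unfolding minimal_graded_free_resolution_def
proof (intro conjI allI ballI graded_free_resolution_bm)
  fix n f c
  have max: "(max_ideal :: ('v, 'k) mpol set) = ideal_gen (monom ` range (\<lambda>v. Poly_Mapping.single v 1))"
    by (simp add: max_ideal_def var_def image_image)
  interpret mod: module "(*) :: ('v, 'k) mpol \<Rightarrow> _" by (rule module_times)
  have entry: "entry C b c \<in> (max_ideal :: ('v, 'k) mpol set)" if b: "b \<in> basis C (Suc n)" for b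
    unfolding max monomial_ideal_iff
  proof (intro allI impI)
    fix t
    assume "Poly_Mapping.lookup (entry C b c) t \<noteq> 0"
    then have t: "t = mon_lcm b - mon_lcm c" and nz: "coef b c \<noteq> (0 :: 'k)"
      by (auto simp: entry_C lookup_single when_def split: if_splits)
    obtain \<rho> where \<rho>: "facet b \<rho>" "mon_dvd (mon_lcm c) (mon_lcm \<rho>)" "mon_dvd (mon_lcm \<rho>) (mon_lcm b)"
      using coef_nonzeroD[OF basis_sub[OF b] nz] .
    have "\<not> bridge b m" for m
      using b friendly by (intro critical_no_bridge) (auto simp: bridge_friendly_wrt_def basis_C)
    then have "mon_lcm \<rho> \<noteq> mon_lcm b" using \<rho>(1) unfolding facet_def bridge_def by metis
    then have ne: "mon_lcm c \<noteq> mon_lcm b" using \<rho> mon_dvd_antisym by metis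
    have "t \<noteq> 0"
      using ne mon_dvd_diff_add[OF coef_dvd[OF b nz]] t by auto
    then obtain v where "Poly_Mapping.lookup t v \<noteq> 0"
      by (metis lookup_zero poly_mapping_eqI)
    then have "mon_dvd (Poly_Mapping.single v 1) t"
      by (auto simp: mon_dvd_def lookup_single when_def)
    then show "\<exists>s\<in>range (\<lambda>v. Poly_Mapping.single v 1). mon_dvd s t" by blast
  qed
  show "differential C n f c \<in> max_ideal"
  proof (cases "c \<in> basis C n")
    case True
    then show ?thesis
      using entry unfolding differential_def max_ideal_def ideal_gen_def
      by (auto intro!: mod.span_sum mod.span_scale)
  next
    case False
    then show ?thesis
      unfolding differential_def max_ideal_def ideal_gen_def by (simp add: mod.span_zero)
  qed
qed

end


section \<open>A criterion for bridge-friendliness\<close>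

context ordered_gens
begin

text \<open>
  If two potentially type-2 sets \<open>insert a \<omega>\<close> and \<open>insert b \<omega>\<close> with smallest bridges \<open>a > b\<close>
  compete, then \<open>b\<close> is a gap but not a true gap of the former.  So some \<open>c < b\<close> in \<open>\<omega>\<close> becomes
  a bridge only after adjoining both \<open>a\<close> and \<open>b\<close>, each of which has a variable to contribute.
\<close>

lemma pot_type2_imp_type2:
  assumes no: "\<And>a b c x y. \<lbrakk>a \<in> G; b \<in> G; c \<in> G; rk c < rk b; rk b < rk a;
      Poly_Mapping.lookup c x \<le> Poly_Mapping.lookup b x;
      Poly_Mapping.lookup a x < Poly_Mapping.lookup c x;
      Poly_Mapping.lookup c y \<le> Poly_Mapping.lookup a y;
      Poly_Mapping.lookup b y < Poly_Mapping.lookup c y\<rbrakk> \<Longrightarrow> False"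
    and \<sigma>: "pot_type2 G r \<sigma>"
  shows "type2 G r \<sigma>"
proof (rule ccontr)
  assume "\<not> type2 G r \<sigma>"
  then obtain \<tau> where \<tau>: "pot_type2 G r \<tau>" "\<tau> \<noteq> \<sigma>" "mate \<sigma> = mate \<tau>"
      and ndom: "\<not> dominates r (sb r \<tau>) (sb r \<sigma>)"
    using \<sigma> unfolding type2_def by blast
  define a b \<omega> where "a = sb r \<sigma>" "b = sb r \<tau>" "\<omega> = mate \<sigma>"
  note defs = this
  have ba: "bridge \<sigma> a" "bridge \<tau> b" using pot_type2_sb \<sigma> \<tau>(1) defs by auto
  have sub: "\<sigma> \<subseteq> G" "\<tau> \<subseteq> G" using pot_type2_sub \<sigma> \<tau>(1) by auto
  have ins: "\<sigma> = insert a \<omega>" "\<tau> = insert b \<omega>" "a \<notin> \<omega>" "b \<notin> \<omega>"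
    using bridge_mem[OF ba(1)] bridge_mem[OF ba(2)] \<tau>(3) defs by auto
  have mem: "a \<in> G" "b \<in> G" "a \<noteq> b" using ins sub \<tau>(2) by auto
  have rk_ba: "rk b < rk a"
    using ndom dominates_iff_rk[of b a] rk_inj[of a b] mem defs by (metis linorder_neqE_nat)
  have lcm: "mon_lcm \<sigma> = mon_lcm \<tau>"
    using mon_lcm_mate[OF \<sigma>] mon_lcm_mate[OF \<tau>(1)] \<tau>(3) by simp
  have "gap G \<sigma> b"
    unfolding gap_iff[OF sub(1)] lcm using ins mem finite_sub[OF sub(2)] by (auto intro: dvd_mon_lcm)
  moreover have "\<not> true_gap G r \<sigma> b"
    using \<sigma> rk_ba unfolding pot_type2_iff defs by fastforce
  ultimately obtain c where c: "bridge (insert b \<sigma>) c" "dominates r b c" "\<not> bridge \<sigma> c"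
    unfolding true_gap_def by blast
  have cG: "c \<in> G" using bridge_mem[OF c(1)] sub mem by auto
  then have rk_cb: "rk c < rk b" using c(2) mem dominates_iff_rk by blast
  then have c\<omega>: "c \<in> \<omega>" using bridge_mem[OF c(1)] ins rk_ba by auto
  have "\<not> bridge \<tau> c" using sb_bridge_least(2)[OF sub(2)] rk_cb defs by fastforce
  then have ndvd: "\<not> mon_dvd c (mon_lcm (\<sigma> - {c}))" "\<not> mon_dvd c (mon_lcm (\<tau> - {c}))"
    using c(3) c\<omega> ins bridge_iff sub by auto
  have fin: "finite \<sigma>" "finite \<tau>" using sub finite_sub by auto
  have dvd: "mon_dvd c (mon_lcm (insert a (insert b \<omega>) - {c}))"
    using c(1) bridge_iff[of "insert b \<sigma>" c] sub mem ins by (simp add: insert_commute)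
  obtain x where x: "Poly_Mapping.lookup c x \<noteq> 0"
      "\<forall>n\<in>\<sigma> - {c}. Poly_Mapping.lookup n x < Poly_Mapping.lookup c x"
    using ndvd(1) fin by (auto simp: dvd_mon_lcm_iff not_le)
  obtain y where y: "Poly_Mapping.lookup c y \<noteq> 0"
      "\<forall>n\<in>\<tau> - {c}. Poly_Mapping.lookup n y < Poly_Mapping.lookup c y"
    using ndvd(2) fin by (auto simp: dvd_mon_lcm_iff not_le)
  have dvd': "\<exists>n\<in>insert a (insert b \<omega>) - {c}. Poly_Mapping.lookup c v \<le> Poly_Mapping.lookup n v"
    if "Poly_Mapping.lookup c v \<noteq> 0" for v
    using dvd that fin ins dvd_mon_lcm_iff[of "insert a (insert b \<omega>) - {c}" c]
    by (metis finite_Diff finite_insert)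
  have "Poly_Mapping.lookup c x \<le> Poly_Mapping.lookup b x"
    using dvd'[OF x(1)] x(2) ins by (metis Diff_iff insert_iff not_le)
  moreover have "Poly_Mapping.lookup c y \<le> Poly_Mapping.lookup a y"
    using dvd'[OF y(1)] y(2) ins by (metis Diff_iff insert_iff not_le)
  moreover have "Poly_Mapping.lookup a x < Poly_Mapping.lookup c x"
    using x(2) ins c\<omega> by auto
  moreover have "Poly_Mapping.lookup b y < Poly_Mapping.lookup c y"
    using y(2) ins c\<omega> by auto
  ultimately show False using no[OF mem(1,2) cG rk_cb rk_ba] by blast
qed

end


section \<open>Closed neighborhood ideals of trees\<close>

lemma exists_leaf:
  fixes E :: "'v \<Rightarrow> 'v \<Rightarrow> bool"
  assumes graph: "simple_graph E" and acyclic: "\<nexists>p. graph_cycle E p"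
    and S: "finite S" "S \<noteq> {}"
  shows "\<exists>v\<in>S. \<forall>u\<in>S. \<forall>w\<in>S. E v u \<longrightarrow> E v w \<longrightarrow> u = w"
proof (rule ccontr)
  assume no: "\<not> ?thesis"
  have sym: "E a b \<Longrightarrow> E b a" and irr: "\<not> E a a" for a b
    using graph by (auto simp: simple_graph_def symp_def irreflp_def)
  define Q where "Q p \<longleftrightarrow> p \<noteq> [] \<and> distinct p \<and> set p \<subseteq> S \<and> successively E p" for p
  have len: "length p \<le> card S" if "Q p" for p
    using that S(1) card_mono[of S "set p"] by (simp add: Q_def distinct_card)
  obtain s where "s \<in> S" using S(2) by blast
  then have "Q [s]" by (simp add: Q_def)
  then obtain p where p: "Q p" and max: "\<And>q. Q q \<Longrightarrow> length q \<le> length p"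
    using ex_has_greatest_nat[of Q "[s]" length "Suc (card S)"] len by (metis less_Suc_eq_le)
  then obtain v q where vq: "p = v # q" by (cases p) (auto simp: Q_def)
  then have v: "v \<in> S" using p by (simp add: Q_def)
  \<comment> \<open>By maximality every neighbor of the first vertex lies on the path.\<close>
  have on: "u \<in> set q" if "u \<in> S" "E v u" for u
  proof (rule ccontr)
    assume "u \<notin> set q"
    then have "Q (u # p)"
      using that p irr[of v] sym[of v u] by (auto simp: Q_def vq)
    then show False using max by fastforce
  qed
  obtain u w where uw: "u \<in> S" "w \<in> S" "E v u" "E v w" "u \<noteq> w" using no v by blast
  then obtain z where z: "z \<in> set q" "E v z" "z \<noteq> hd q" using on by metis
  then obtain q1 q2 where q: "q = q1 @ z # q2" by (meson split_list)
  have q1: "q1 \<noteq> []" using z q by auto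
  have "successively E ((v # q1 @ [z]) @ q2)" "distinct ((v # q1 @ [z]) @ q2)"
    using p vq q by (auto simp: Q_def)
  then have "successively E (v # q1 @ [z])" "distinct (v # q1 @ [z])"
    unfolding successively_append_iff distinct_append by blast+
  then have "graph_cycle E (v # q1 @ [z])"
    unfolding graph_cycle_def using q1 sym[OF z(2)] by (auto simp: Suc_le_eq)
  then show False using acyclic by blast
qed

text \<open>
  Removing leaves one by one numbers the vertices of a forest so that each has at most one
  neighbor with a smaller number, as for the depth in a rooted tree.
\<close>

lemma forest_numbering:
  fixes E :: "'v \<Rightarrow> 'v \<Rightarrow> bool"
  assumes graph: "simple_graph E" and acyclic: "\<nexists>p. graph_cycle E p" and "finite S"
  shows "\<exists>e :: 'v \<Rightarrow> nat. inj_on e S \<and>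
    (\<forall>v\<in>S. \<forall>u\<in>S. \<forall>w\<in>S. E v u \<longrightarrow> E v w \<longrightarrow> e u < e v \<longrightarrow> e w < e v \<longrightarrow> u = w)"
  using \<open>finite S\<close>
proof (induction "card S" arbitrary: S)
  case 0
  then show ?case by auto
next
  case (Suc n)
  then have "S \<noteq> {}" by auto
  then obtain l where l: "l \<in> S" "\<And>u w. u \<in> S \<Longrightarrow> w \<in> S \<Longrightarrow> E l u \<Longrightarrow> E l w \<Longrightarrow> u = w"
    using exists_leaf[OF graph acyclic Suc.prems] by metis
  have "n = card (S - {l})" using Suc.hyps(2) Suc.prems l(1) by simp
  then obtain e :: "'v \<Rightarrow> nat" where e: "inj_on e (S - {l})"
      "\<forall>v\<in>S - {l}. \<forall>u\<in>S - {l}. \<forall>w\<in>S - {l}.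
         E v u \<longrightarrow> E v w \<longrightarrow> e u < e v \<longrightarrow> e w < e v \<longrightarrow> u = w"
    using Suc.hyps(1)[of "S - {l}"] Suc.prems by auto
  obtain N where N: "\<And>v. v \<in> S \<Longrightarrow> e v < N"
    using Suc.prems by (metis finite_imageI finite_nat_set_iff_bounded imageI)
  have "inj_on (e(l := N)) (S - {l})"
    using e(1) by (subst inj_on_cong[of _ _ e]) auto
  moreover have "N \<notin> e ` (S - {l})" using N by fastforce
  then have "(e(l := N)) l \<notin> (e(l := N)) ` (S - {l} - {l})" by auto
  ultimately have "inj_on (e(l := N)) (insert l (S - {l}))" unfolding inj_on_insert by blast
  then have "inj_on (e(l := N)) S" using l(1) by (simp add: insert_absorb)
  moreover have "u = w"
    if "v \<in> S" "u \<in> S" "w \<in> S" "E v u" "E v w"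
      "(e(l := N)) u < (e(l := N)) v" "(e(l := N)) w < (e(l := N)) v" for v u w
  proof (cases "v = l")
    case True
    then show ?thesis using l(2) that by blast
  next
    case False
    then have ne: "u \<noteq> l" "w \<noteq> l" using that(6,7) N[OF that(1)] by auto
    then have "e u < e v" "e w < e v" using that(6,7) False by auto
    then show ?thesis using e(2) that(1-5) False ne by blast
  qed
  ultimately show ?case by blast
qed

text \<open>The generator of the closed neighborhood ideal that belongs to a vertex.\<close>

definition nbhd_mon :: "('v::finite \<Rightarrow> 'v \<Rightarrow> bool) \<Rightarrow> 'v \<Rightarrow> 'v mon" where
  "nbhd_mon E v = (\<Sum>y\<in>closed_nbhd E v. Poly_Mapping.single y 1)"

lemma lookup_nbhd_mon:
  "Poly_Mapping.lookup (nbhd_mon E v) x = (if x \<in> closed_nbhd E v then 1 else 0)"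
  by (simp add: nbhd_mon_def lookup_sum lookup_single when_def)

lemma prod_var:
  "finite A \<Longrightarrow>
    (\<Prod>y\<in>A. var y) = (monom (\<Sum>y\<in>A. Poly_Mapping.single y 1) :: ('v, 'k::field) mpol)"
  by (induction A rule: finite_induct) (simp_all add: var_def monom_mult, simp add: monom_def)

lemma closed_nbhd_ideal_eq:
  "(closed_nbhd_ideal E :: ('v::finite, 'k::field) mpol set) = ideal_gen (monom ` range (nbhd_mon E))"
  unfolding closed_nbhd_ideal_def by (rule arg_cong[of _ _ ideal_gen]) (auto simp: prod_var nbhd_mon_def)

text \<open>
  The path from \<open>a\<close> to \<open>b\<close> would run through \<open>c\<close> as an inner vertex.  At most one neighbor of \<open>c\<close>
  has a smaller number, and in the direction of another neighbor the numbers increase, so \<open>a\<close> or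
  \<open>b\<close> would have a larger number than \<open>c\<close>.
\<close>

lemma no_obstruction_in_forest:
  fixes e :: "'v \<Rightarrow> nat"
  assumes graph: "simple_graph E" and inj: "inj e"
    and parent: "\<And>v u w. E v u \<Longrightarrow> E v w \<Longrightarrow> e u < e v \<Longrightarrow> e w < e v \<Longrightarrow> u = w"
    and less: "e a < e c" "e b < e c"
    and x: "x \<in> closed_nbhd E c" "x \<in> closed_nbhd E b" "x \<notin> closed_nbhd E a"
    and y: "y \<in> closed_nbhd E c" "y \<in> closed_nbhd E a" "y \<notin> closed_nbhd E b"
  shows False
proof -
  have sym: "E a b \<Longrightarrow> E b a" for a b using graph by (auto simp: simple_graph_def symp_def)
  \<comment> \<open>A common element with the neighborhood of \<open>a\<close> or \<open>b\<close> is \<open>c\<close> or the parent of \<open>c\<close>.\<close>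
  have up: "E c z \<and> e z < e c"
    if z: "z \<in> closed_nbhd E c" "z \<noteq> c" and d: "z \<in> closed_nbhd E d" "e d < e c" for z d
  proof -
    have cz: "E c z" using z by (auto simp: closed_nbhd_def)
    have "\<not> e c < e z"
    proof
      assume "e c < e z"
      then have "E z d" using d sym by (auto simp: closed_nbhd_def)
      then have "c = d" using parent[of z c d] sym[OF cz] \<open>e c < e z\<close> d(2) by linarith
      then show False using d(2) by simp
    qed
    moreover have "e z \<noteq> e c" using z(2) inj by (auto dest: injD)
    ultimately show ?thesis using cz by linarith
  qed
  have "x = c \<or> y = c"
    using up[OF x(1) _ x(2) less(2)] up[OF y(1) _ y(2) less(1)] parent[of c x y] x y by blast
  then show False
  proof
    assume "x = c"
    then have "E c b" "y \<noteq> c" using x y less sym by (auto simp: closed_nbhd_def)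
    then have "y = b" using up[OF y(1) _ y(2) less(1)] parent[of c y b] less by blast
    then show False using y by (simp add: closed_nbhd_def)
  next
    assume "y = c"
    then have "E c a" "x \<noteq> c" using x y less sym by (auto simp: closed_nbhd_def)
    then have "x = a" using up[OF x(1) _ x(2) less(2)] parent[of c x a] less by blast
    then show False using x by (simp add: closed_nbhd_def)
  qed
qed

lemma bridge_friendly_forest:
  fixes E :: "'v::finite \<Rightarrow> 'v \<Rightarrow> bool"
  assumes graph: "simple_graph E" and acyclic: "\<nexists>p. graph_cycle E p"
  shows "bridge_friendly (closed_nbhd_ideal E :: ('v, 'k::field) mpol set)"
proof -
  let ?I = "closed_nbhd_ideal E :: ('v, 'k) mpol set"
  obtain e :: "'v \<Rightarrow> nat" where e: "inj e"
      "\<And>v u w. E v u \<Longrightarrow> E v w \<Longrightarrow> e u < e v \<Longrightarrow> e w < e v \<Longrightarrow> u = w"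
    using forest_numbering[OF graph acyclic finite_UNIV] by auto
  define vert where "vert = inv (nbhd_mon E)"
  have G_sub: "min_gens ?I \<subseteq> range (nbhd_mon E)"
    by (auto simp: closed_nbhd_ideal_eq min_gens_monomial_ideal)
  have vert: "nbhd_mon E (vert g) = g" if "g \<in> min_gens ?I" for g
    using that G_sub unfolding vert_def by (meson f_inv_into_f subsetD)
  \<comment> \<open>Generators of vertices with larger numbers, the deeper ones, are smaller.\<close>
  define r where "r = {(g, h). g \<in> min_gens ?I \<and> h \<in> min_gens ?I \<and> e (vert h) \<le> e (vert g)}"
  have eq: "g = h" if "g \<in> min_gens ?I" "h \<in> min_gens ?I" "e (vert h) = e (vert g)" for g h
    using that vert e(1) by (metis injD)
  have lin: "linear_order_on (min_gens ?I) r"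
    unfolding order_on_defs refl_on_def trans_def antisym_def total_on_def r_def
    using eq by (auto intro: le_antisym)
  interpret monomial_ideal_order "range (nbhd_mon E)" ?I r
    by unfold_locales (use lin in \<open>auto simp: closed_nbhd_ideal_eq\<close>)
  have e_less: "e (vert b) < e (vert c)" if "b \<in> min_gens ?I" "c \<in> min_gens ?I" "rk c < rk b" for b c
    using that le_iff_rk[of b c] by (auto simp: r_def)
  have "type2 (min_gens ?I) r \<sigma>" if "pot_type2 (min_gens ?I) r \<sigma>" for \<sigma>
  proof (rule pot_type2_imp_type2[OF _ that])
    fix a b c x y
    assume mem: "a \<in> min_gens ?I" "b \<in> min_gens ?I" "c \<in> min_gens ?I"
      and rk: "rk c < rk b" "rk b < rk a"
      and xy: "Poly_Mapping.lookup c x \<le> Poly_Mapping.lookup b x"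
        "Poly_Mapping.lookup a x < Poly_Mapping.lookup c x"
        "Poly_Mapping.lookup c y \<le> Poly_Mapping.lookup a y"
        "Poly_Mapping.lookup b y < Poly_Mapping.lookup c y"
    have lookup: "Poly_Mapping.lookup g z = (if z \<in> closed_nbhd E (vert g) then 1 else 0)"
      if "g \<in> min_gens ?I" for g z
      using lookup_nbhd_mon[of E "vert g" z] vert[OF that] by simp
    show False
      using e_less[OF mem(1,3)] e_less[OF mem(2,3)] rk xy lookup[OF mem(1)] lookup[OF mem(2)]
        lookup[OF mem(3)]
      by (intro no_obstruction_in_forest[OF graph e, where a = "vert a" and b = "vert b" and c = "vert c" and x = x and y = y])
        (auto split: if_splits)
  qed
  then show ?thesis
    unfolding bridge_friendly_def bridge_friendly_wrt_def using lin by blast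
qed

theorem theorem3p4:
  fixes E :: "'v::finite \<Rightarrow> 'v \<Rightarrow> bool"
  assumes "tree E"
  shows "bridge_friendly (closed_nbhd_ideal E :: ('v, 'k::field) mpol set) \<and>
    (\<forall>r. bridge_friendly_wrt (closed_nbhd_ideal E :: ('v, 'k) mpol set) r \<longrightarrow>
       minimal_graded_free_resolution
         (bm_resolution (closed_nbhd_ideal E :: ('v, 'k) mpol set) r) (closed_nbhd_ideal E))"
proof (intro conjI allI impI)
  show "bridge_friendly (closed_nbhd_ideal E :: ('v, 'k) mpol set)"
    using assms bridge_friendly_forest unfolding tree_def by blast
next
  fix r
  assume friendly: "bridge_friendly_wrt (closed_nbhd_ideal E :: ('v, 'k) mpol set) r"
  then interpret monomial_ideal_order "range (nbhd_mon E)"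
      "closed_nbhd_ideal E :: ('v, 'k) mpol set" r
    by unfold_locales (simp_all add: closed_nbhd_ideal_eq bridge_friendly_wrt_def)
  show "minimal_graded_free_resolution
      (bm_resolution (closed_nbhd_ideal E :: ('v, 'k) mpol set) r) (closed_nbhd_ideal E)"
    by (rule minimal_bm[OF friendly])
qed

end
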